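(* If $\mathcal A$ is a basic algebra, then the $F_5$ algorithm described in the context, applied to the generating set $\{\hat g_1,\dots,\hat g_m\}$ of $M$, terminates.
   Context: Algebra. Let $K$ be a field and $\mathcal P$ the path algebra over $K$ of a finite quiver $Q$. Its monomials $\mathrm{Mon}(\mathcal P)$ are the directed paths in $Q$ (including the trivial path $1_v$ at each vertex $v$); they form a $K$-basis of $\mathcal P$; $b\cdot c$ is the concatenation if $b$ ends where $c$ starts, and $0$ otherwise; $\deg$ is path length. A monomial ordering of $\mathcal P$ is a total ordering $>$ on $\mathrm{Mon}(\mathcal P)$ such that $b_1>b_2$ implies $b_1b>b_2b$ and $b'b_1>b'b_2$ for all monomials $b_1,b_2,b,b'$ such that $b_1b$, $b_2b$, $b'b_1$ and $b'b_2$ are all non-zero; fix one. The leading monomial $\mathrm{lm}(p)$ of $p\ne0$ is the greatest monomial occurring in $p$, and $\mathrm{lc}(p)$ is its coefficient. Let $\psi:\mathcal P\to\mathcal A$ be the quotient map onto a quotient algebra $\mathcal A$. That $\mathcal A$ is a basic algebra means that it is finite-dimensional over $K$ and that the relations are at least quadratic: every element of $\ker\psi$ is a linear combination of paths of length at least $2$. Let $\mathrm{stdMon}$ be the set of monomials of $\mathcal P$ that are not leading monomials of elements of $\ker\psi$. Then $\psi$ is injective on $\mathrm{stdMon}$ and $\mathcal B_>(\mathcal A)=\psi(\mathrm{stdMon})$ is a $K$-basis of $\mathcal A$, whose elements are called the monomials of $\mathcal A$. For $b\in\mathcal B_>(\mathcal A)$, $\lambda(b)$ is the unique element of $\mathrm{stdMon}$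 with $\psi(\lambda(b))=b$; $b>b'$ iff $\lambda(b)>\lambda(b')$. Leading monomials and coefficients of non-zero elements of $\mathcal A$ are taken with respect to this basis. For $b,b'\in\mathcal B_>(\mathcal A)$, $b\parallel b'$ ($b$ strictly divides $b'$) means $\lambda(b')=\lambda(b)\cdot d$ for some $d\in\mathrm{Mon}(\mathcal P)$. Let $b\in\mathcal B_>(\mathcal A)$, $t\in\mathcal B_>(\mathcal A)\cup\{0\}$. If there is $c\in\mathcal B_>(\mathcal A)$ such that either $\mathrm{lm}(b\cdot c)=t\neq0$ and $b\not\parallel t$, or $b\cdot c=0=t$, then $t$ is a toppling of $b$ with cofactor $c$. If $c\in\mathcal B_>(\mathcal A)$ is not a cofactor of a toppling of $b$, then $c$ is a small cofactor of $b$. A toppling $t$ of $b$ with cofactor $c$ is minimal if all $c'\in\mathcal B_>(\mathcal A)$ with $c'\parallel c$ and $c'\neq c$ are small cofactors of $b$. Modules. $F=\mathcal A^r$ is the free right-$\mathcal A$ module with free generators $\mathfrak v_1,\dots,\mathfrak v_r$ and monomials $\mathfrak v_i\cdot b$ ($b\in\mathcal B_>(\mathcal A)$), with a fixed total ordering on its monomials compatible with $>$: $b_1>b_2$ implies $\mathfrak v_ib_1>\mathfrak v_ib_2$; and $\mathfrak v_ib_1>\mathfrak v_jb_2$ implies $\mathfrak v_ib_1b>\mathfrak v_j\mathrm{lm}(b_2b)$ or $b_2b=0$, for all $i,j$ and all monomials $b_1,b_2,b$ of $\mathcal A$ such that $b$ is a small cofactor of $b_1$. $\mathrm{lm},\mathrm{lc}$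 are defined accordingly for non-zero elements of $F$. Small cofactors and (minimal) topplings of $\mathfrak v_ib$ are understood via $b$. Signatures. $M\subseteq F$ is a submodule with a fixed finite ordered generating set $\hat g_1,\dots,\hat g_m$. $E=\mathcal P^m$ is the free right-$\mathcal P$ module with free generators $\mathfrak e_1,\dots,\mathfrak e_m$, monomials $\mathrm{Mon}(E)=\{\mathfrak e_i\cdot b: b\in\mathrm{Mon}(\mathcal P)\}$ (the generators $\mathfrak e_i$ themselves are also used as monomials, i.e. as signatures), and a fixed monomial ordering compatible with that of $\mathcal P$: $b_1>b_2$ implies $\mathfrak e_ib_1>\mathfrak e_ib_2$; and $\mathfrak e_ib_1>\mathfrak e_jb_2$ implies $\mathfrak e_ib_1b>\mathfrak e_jb_2b$ whenever both products are non-zero. $ev:E\to M$ is the $K$-linear map with $ev(\mathfrak e_i\cdot c)=\hat g_i\cdot\psi(c)$. A signed element of $M$ is a pair $f=(f_u,s)$ with $f_u\in M$, $s\in\mathrm{Mon}(E)$ such that some $\tilde f\in E$ has $\mathrm{lm}(\tilde f)=s$ and $ev(\tilde f)=f_u$; write $\mathrm{poly}(f)=f_u$, $\sigma(f)=s$, $\mathrm{lm}(f)=\mathrm{lm}(f_u)$, $\mathrm{lc}(f)=\mathrm{lc}(f_u)$. It is a signed element of $M\setminus\{0\}$ if $f_u\neq0$; a signed subset is a set of signed elements. For $f\in F$, $s\in\mathrm{Mon}(E)$ and a signed subset $G$ of $M\setminus\{0\}$: $f$ is $s$-reducible with respect to $G$ if there are $g\in G$ and a small cofactor $c$ of $\mathrm{lm}(g)$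 with $\mathrm{lm}(g)\cdot c=\mathrm{lm}(f)$ and $\sigma(g)\cdot\lambda(c)<s$; $f$ is $s$-irreducible if $f=0$ or $f$ is not $s$-reducible. For a signed element $f$, reducible/irreducible means that $\mathrm{poly}(f)$ is so with $s=\sigma(f)$. A finite signed subset $G$ of $M\setminus\{0\}$ is interreduced if every $g\in G$ is irreducible with respect to $G$ and there are no distinct $g,g'\in G$ with a small cofactor $c$ of $\mathrm{lm}(g')$ such that $\mathrm{lm}(g')\cdot c=\mathrm{lm}(g)$ and $\sigma(g')\cdot\lambda(c)=\sigma(g)$. Critical pairs of $G$. Type T: $p=(g,c)$ with $g\in G$ and $c$ the cofactor of a minimal toppling of $\mathrm{lm}(g)$; its S-polynomial is $\mathcal S(p)=(\mathrm{poly}(g)\cdot c,\ \sigma(g)\cdot\lambda(c))$. Type S with cofactor $c$: $p=(g,g')$ with $g,g'\in G$, $c$ a small cofactor of $\mathrm{lm}(g)$, $\mathrm{lm}(g')=\mathrm{lm}(g)\cdot c$ and $\sigma(g')<\sigma(g)\cdot\lambda(c)$; its S-polynomial is $\mathcal S(p)=(\mathrm{poly}(g)\cdot c-\frac{\mathrm{lc}(g)}{\mathrm{lc}(g')}\mathrm{poly}(g'),\ \sigma(g)\cdot\lambda(c))$. Let $L$ be a finite set of monomials of $E$, each of which is the leading monomial of some element of $\ker(ev)$. A monomial $\mathfrak e_i\cdot c$ of $E$ is standard relative to $L$ if $c\in\mathrm{stdMon}$ and there are no monomials $c',b,d$ of $\mathcal P$ with $\mathfrak e_i\cdot c'\in L$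 and $c=b\cdot c'\cdot d$. A critical pair $(g,c)$ of type T (resp. $(g,g')$ of type S with cofactor $c$) is normal relative to $L$ if $\sigma(g)\cdot\lambda(c)$ is standard relative to $L$ and $g$ is irreducible (resp. both $g$ and $g'$ are irreducible) with respect to $G$. Procedures. For a signed element $f$, $\mathrm{NF}(f,G)$ is computed as follows: start with $f_r=\mathrm{poly}(f)$; while $f_r\ne0$ and there are some $g\in G$ and a small cofactor $c$ of $\mathrm{lm}(g)$ with $\mathrm{lm}(g)\cdot c=\mathrm{lm}(f_r)$ and $\sigma(g)\cdot\lambda(c)<\sigma(f)$, replace $f_r$ by $f_r-\frac{\mathrm{lc}(f_r)}{\mathrm{lc}(g)}\mathrm{poly}(g)\cdot c$; finally $\mathrm{NF}(f,G)=(f_r,\sigma(f))$. $\mathrm{interred}(G)$ is the interreduced finite signed subset obtained from $G$ by repeating as long as possible: (i) if some $g\in G$ has $g'=\mathrm{NF}(g,G\setminus\{g\})\neq g$, replace $g$ by $g'$, or remove $g$ if $\mathrm{poly}(g')=0$ (a zero reduction, which shows that $\sigma(g)$ is the leading monomial of an element of $\ker(ev)$); (ii) if there are distinct $g,g'\in G$ and a small cofactor $c$ of $\mathrm{lm}(g')$ with $\mathrm{lm}(g')\cdot c=\mathrm{lm}(g)$ and $\sigma(g')\cdot\lambda(c)=\sigma(g)$, remove $g$. $F_5$ algorithm. Start with $G=\mathrm{interred}(\{(\hat g_i,\mathfrak e_i): i=1,\dots,m\})$ and $L=\emptyset$. While there is a critical pair $p$ of $G$ that is normal relative to $L$ so that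 it is impossible to find $g\in G$ and a small cofactor $c$ of $\mathrm{lm}(g)$ such that $\sigma(g)\cdot\lambda(c)=\sigma(\mathcal S(p))$ and $\mathrm{poly}(g)\cdot c$ is $\sigma(\mathcal S(p))$-irreducible with respect to $G$: let $s=\mathrm{NF}(\mathcal S(p),G)$; if $\mathrm{poly}(s)=0$, replace $L$ by $L\cup\{\sigma(s)\}$; otherwise replace $G$ by $\mathrm{interred}(G\cup\{s\})$, enlarging $L$ (by the signature concerned) if a zero reduction occurs. When the loop ends, return $G$. *)

theory Defs
  imports
    "Graph_Theory.Arc_Walk"
    "HOL-Library.Poly_Mapping"
    "HOL-Algebra.RingHom"
    "HOL-Algebra.Embedded_Algebras"
begin

section \<open>Path algebras\<close>

text \<open>
  A finite quiver is a \<^locale>\<open>fin_digraph\<close>: loops and parallel arcs are allowed. A path is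
  given by its start vertex and the list of its arcs; the start vertex is needed to tell the
  trivial paths apart.
\<close>

type_synonym ('v, 'e) path = "'v \<times> 'e list"

definition paths :: "('v, 'e) pre_digraph \<Rightarrow> ('v, 'e) path set" where
  "paths Q = {(u, p). \<exists>v. pre_digraph.awalk Q u p v}"

definition path_end :: "('v, 'e) pre_digraph \<Rightarrow> ('v, 'e) path \<Rightarrow> 'v" where
  "path_end Q b = pre_digraph.awlast Q (fst b) (snd b)"

definition composable :: "('v, 'e) pre_digraph \<Rightarrow> ('v, 'e) path \<Rightarrow> ('v, 'e) path \<Rightarrow> bool" where
  "composable Q b c \<longleftrightarrow> path_end Q b = fst c"

definition path_comp :: "('v, 'e) path \<Rightarrow> ('v, 'e) path \<Rightarrow> ('v, 'e) path" where
  "path_comp b c = (fst b, snd b @ snd c)"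

abbreviation mono_of :: "('v, 'e) path \<Rightarrow> (('v, 'e) path \<Rightarrow>\<^sub>0 'k::field)" where
  "mono_of b \<equiv> Poly_Mapping.single b 1"

definition path_mult ::
  "('v, 'e) pre_digraph \<Rightarrow> (('v, 'e) path \<Rightarrow>\<^sub>0 'k::field) \<Rightarrow> (('v, 'e) path \<Rightarrow>\<^sub>0 'k) \<Rightarrow> (('v, 'e) path \<Rightarrow>\<^sub>0 'k)"
  where
  "path_mult Q p q =
    (\<Sum>b\<in>Poly_Mapping.keys p. \<Sum>c\<in>Poly_Mapping.keys q.
       if composable Q b c
       then Poly_Mapping.single (path_comp b c) (Poly_Mapping.lookup p b * Poly_Mapping.lookup q c) else 0)"

definition path_algebra :: "('v, 'e) pre_digraph \<Rightarrow> (('v, 'e) path \<Rightarrow>\<^sub>0 'k::field) ring" where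
  "path_algebra Q =
    \<lparr>carrier = {p. Poly_Mapping.keys p \<subseteq> paths Q}, mult = path_mult Q,
     one = (\<Sum>v\<in>verts Q. mono_of (v, [])), zero = 0, add = (+)\<rparr>"

lemma path_end_comp: "composable Q b c \<Longrightarrow> path_end Q (path_comp b c) = path_end Q c"
proof -
  have "pre_digraph.awlast Q u (p @ q) =
      pre_digraph.awlast Q (pre_digraph.awlast Q u p) q" for u p q
    by (induction p arbitrary: u)
      (simp_all add: pre_digraph.awalk_verts.simps pre_digraph.awalk_verts_non_Nil)
  then show "composable Q b c \<Longrightarrow> path_end Q (path_comp b c) = path_end Q c"
    by (simp add: composable_def path_end_def path_comp_def)
qed

lemma path_mult_superset:
  assumes "finite B" "finite C" "Poly_Mapping.keys p \<subseteq> B" "Poly_Mapping.keys q \<subseteq> C"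
  shows "path_mult Q p q =
    (\<Sum>b\<in>B. \<Sum>c\<in>C. if composable Q b c
       then Poly_Mapping.single (path_comp b c) (Poly_Mapping.lookup p b * Poly_Mapping.lookup q c) else 0)"
proof -
  let ?h = "\<lambda>b c. if composable Q b c
       then Poly_Mapping.single (path_comp b c) (Poly_Mapping.lookup p b * Poly_Mapping.lookup q c) else 0"
  have "(\<Sum>b\<in>B. \<Sum>c\<in>C. ?h b c) = (\<Sum>b\<in>Poly_Mapping.keys p. \<Sum>c\<in>C. ?h b c)"
    by (rule sum.mono_neutral_right) (use assms in \<open>auto simp: in_keys_iff intro!: sum.neutral\<close>)
  also have "\<dots> = (\<Sum>b\<in>Poly_Mapping.keys p. \<Sum>c\<in>Poly_Mapping.keys q. ?h b c)"
    by (rule sum.cong[OF refl], rule sum.mono_neutral_right)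
      (use assms in \<open>auto simp: in_keys_iff\<close>)
  finally show ?thesis
    by (simp add: path_mult_def)
qed

lemma path_mult_add_left: "path_mult Q (p + p') q = path_mult Q p q + path_mult Q p' q"
proof -
  let ?B = "Poly_Mapping.keys p \<union> Poly_Mapping.keys p'"
  have "Poly_Mapping.keys (p + p') \<subseteq> ?B" by (rule keys_add)
  then show ?thesis
    by (simp add: path_mult_superset[of ?B "Poly_Mapping.keys q"] sum.distrib[symmetric] lookup_add
        distrib_right single_add if_distrib cong: if_cong)
qed

lemma path_mult_add_right: "path_mult Q p (q + q') = path_mult Q p q + path_mult Q p q'"
proof -
  let ?B = "Poly_Mapping.keys q \<union> Poly_Mapping.keys q'"
  have "Poly_Mapping.keys (q + q') \<subseteq> ?B" by (rule keys_add)
  then show ?thesis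
    by (simp add: path_mult_superset[of "Poly_Mapping.keys p" ?B] sum.distrib[symmetric] lookup_add
        distrib_left single_add if_distrib cong: if_cong)
qed

lemma path_mult_zero [simp]: "path_mult Q 0 q = 0" "path_mult Q p 0 = 0"
  by (simp_all add: path_mult_def)

lemma path_mult_sum_left: "path_mult Q (sum f S) q = (\<Sum>s\<in>S. path_mult Q (f s) q)"
  by (induction S rule: infinite_finite_induct) (auto simp: path_mult_add_left)

lemma path_mult_sum_right: "path_mult Q p (sum f S) = (\<Sum>s\<in>S. path_mult Q p (f s))"
  by (induction S rule: infinite_finite_induct) (auto simp: path_mult_add_right)

lemma path_mult_single:
  "path_mult Q (Poly_Mapping.single b x) (Poly_Mapping.single c y) =
    (if composable Q b c then Poly_Mapping.single (path_comp b c) (x * y) else 0)"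
  by (subst path_mult_superset[of "{b}" "{c}"]) auto

lemma poly_mapping_sum_single:
  "p = (\<Sum>b\<in>Poly_Mapping.keys p. Poly_Mapping.single b (Poly_Mapping.lookup p b))"
  by (rule poly_mapping_eqI)
    (auto simp: lookup_sum lookup_single when_def in_keys_iff)

lemma path_mult_assoc: "path_mult Q (path_mult Q p q) r = path_mult Q p (path_mult Q q r)"
proof -
  have single: "path_mult Q (path_mult Q (Poly_Mapping.single b x) (Poly_Mapping.single c y))
        (Poly_Mapping.single d z) =
      path_mult Q (Poly_Mapping.single b x)
        (path_mult Q (Poly_Mapping.single c y) (Poly_Mapping.single d z))" for b c d x y z
  proof -
    have "composable Q (path_comp b c) d \<longleftrightarrow> composable Q c d" if "composable Q b c"
      using path_end_comp[OF that] by (simp add: composable_def)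
    moreover have "composable Q b (path_comp c d) \<longleftrightarrow> composable Q b c"
      by (simp add: composable_def path_comp_def)
    moreover have "path_comp (path_comp b c) d = path_comp b (path_comp c d)"
      by (simp add: path_comp_def)
    ultimately show ?thesis
      by (simp add: path_mult_single mult.assoc)
  qed
  show ?thesis
    by (subst (1 2) poly_mapping_sum_single[of p], subst (1 2) poly_mapping_sum_single[of q],
        subst (1 2) poly_mapping_sum_single[of r])
      (simp only: path_mult_sum_left path_mult_sum_right single)
qed

lemma trivial_path: "v \<in> verts Q \<Longrightarrow> (v, []) \<in> paths Q"
  by (auto simp: paths_def pre_digraph.awalk_def pre_digraph.cas.simps)

lemma (in wf_digraph) path_ends_in_verts:
  "b \<in> paths G \<Longrightarrow> fst b \<in> verts G \<and> path_end G b \<in> verts G"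
  by (auto simp: paths_def path_end_def)

lemma (in wf_digraph) path_comp_in_paths:
  assumes "b \<in> paths G" "c \<in> paths G" "composable G b c"
  shows "path_comp b c \<in> paths G"
  using assms awlast_if_cas
  by (fastforce simp: paths_def path_comp_def composable_def path_end_def awalk_def)

lemma path_algebra_ring:
  assumes "fin_digraph Q"
  shows "ring (path_algebra Q :: (('v, 'e) path \<Rightarrow>\<^sub>0 'k::field) ring)"
proof -
  interpret fin_digraph Q by fact
  let ?P = "path_algebra Q :: (('v, 'e) path \<Rightarrow>\<^sub>0 'k::field) ring"
  have one_keys: "Poly_Mapping.keys (\<Sum>v\<in>V. mono_of (v, []) :: ('v, 'e) path \<Rightarrow>\<^sub>0 'k) \<subseteq> paths Q"
    if "V \<subseteq> verts Q" for V
    using that by (induction V rule: infinite_finite_induct)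
      (auto dest!: subsetD[OF keys_add] intro: trivial_path)
  have mult_keys: "Poly_Mapping.keys (path_mult Q p q) \<subseteq> paths Q"
    if "Poly_Mapping.keys p \<subseteq> paths Q" "Poly_Mapping.keys q \<subseteq> paths Q" for p q :: "('v, 'e) path \<Rightarrow>\<^sub>0 'k"
    unfolding path_mult_def
    by (intro order.trans[OF keys_sum] UN_least)
      (use that in \<open>auto intro!: path_comp_in_paths split: if_splits\<close>)
  have one_left: "path_mult Q (\<Sum>v\<in>verts Q. mono_of (v, [])) p = p"
    if p: "Poly_Mapping.keys p \<subseteq> paths Q" for p :: "('v, 'e) path \<Rightarrow>\<^sub>0 'k"
  proof -
    have "path_mult Q (\<Sum>v\<in>verts Q. mono_of (v, [])) (Poly_Mapping.single b x) =
        Poly_Mapping.single b x" if "b \<in> paths Q" for b and x :: 'k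
      using path_ends_in_verts[OF that]
      by (simp add: path_mult_sum_left path_mult_single composable_def path_end_def
          pre_digraph.awalk_verts.simps path_comp_def cong: if_cong)
    then show ?thesis
      by (subst (1 2) poly_mapping_sum_single[of p], subst path_mult_sum_right)
        (use p in \<open>auto intro!: sum.cong\<close>)
  qed
  have one_right: "path_mult Q p (\<Sum>v\<in>verts Q. mono_of (v, [])) = p"
    if p: "Poly_Mapping.keys p \<subseteq> paths Q" for p :: "('v, 'e) path \<Rightarrow>\<^sub>0 'k"
  proof -
    have "path_mult Q (Poly_Mapping.single b x) (\<Sum>v\<in>verts Q. mono_of (v, [])) =
        Poly_Mapping.single b x" if "b \<in> paths Q" for b and x :: 'k
      using path_ends_in_verts[OF that]
      by (simp add: path_mult_sum_right path_mult_single composable_def path_comp_def)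
    then show ?thesis
      by (subst (1 2) poly_mapping_sum_single[of p], subst path_mult_sum_left)
        (use p in \<open>auto intro!: sum.cong\<close>)
  qed
  show ?thesis
  proof (rule ringI)
    show "abelian_group ?P"
    proof (rule abelian_groupI)
      fix x assume x: "x \<in> carrier ?P"
      show "\<exists>y\<in>carrier ?P. y \<oplus>\<^bsub>?P\<^esub> x = \<zero>\<^bsub>?P\<^esub>"
        by (rule bexI[of _ "- x"]) (use x in \<open>auto simp: path_algebra_def\<close>)
    qed (auto simp: path_algebra_def add.assoc add.commute dest!: subsetD[OF keys_add])
    show "Group.monoid ?P"
      by (rule monoidI)
        (use mult_keys one_keys[of "verts Q"] one_left one_right in
          \<open>auto simp: path_algebra_def path_mult_assoc\<close>)
  qed (auto simp: path_algebra_def path_mult_add_left path_mult_add_right)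
qed


section \<open>Free right modules\<close>

text \<open>
  The free right module of rank \<open>n\<close> over a ring consists of the functions that vanish outside
  \<open>{..<n}\<close>. The product of its \<open>i\<close>-th free generator with a ring element \<open>x\<close> is written as
  the pair \<open>(i, x)\<close>; multiplication from the right acts on the second component.
\<close>

definition free_module :: "('a, 'b) ring_scheme \<Rightarrow> nat \<Rightarrow> (nat \<Rightarrow> 'a) set" where
  "free_module R n = {f. (\<forall>i<n. f i \<in> carrier R) \<and> (\<forall>i\<ge>n. f i = \<zero>\<^bsub>R\<^esub>)}"

definition gen_mult :: "('a, 'b) ring_scheme \<Rightarrow> nat \<times> 'a \<Rightarrow> 'a \<Rightarrow> nat \<times> 'a" where
  "gen_mult R x c = (fst x, snd x \<otimes>\<^bsub>R\<^esub> c)"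

definition greatest :: "('a \<Rightarrow> 'a \<Rightarrow> bool) \<Rightarrow> 'a set \<Rightarrow> 'a" where
  "greatest lt S = (THE x. x \<in> S \<and> (\<forall>y\<in>S. y \<noteq> x \<longrightarrow> lt y x))"

definition strict_total_on :: "'a set \<Rightarrow> ('a \<Rightarrow> 'a \<Rightarrow> bool) \<Rightarrow> bool" where
  "strict_total_on S lt \<longleftrightarrow> irreflp_on S lt \<and> transp_on S lt \<and> totalp_on S lt"

definition halts_from :: "('a \<Rightarrow> 'a \<Rightarrow> bool) \<Rightarrow> 'a \<Rightarrow> bool" where
  "halts_from R x \<longleftrightarrow> \<not> (\<exists>X :: nat \<Rightarrow> 'a. X 0 = x \<and> (\<forall>n. R (X n) (X (Suc n))))"


section \<open>Quotients of path algebras\<close>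

text \<open>
  The order predicates below are strict and read "smaller than".
\<close>

definition monomial_ordering ::
  "('v, 'e) pre_digraph \<Rightarrow> (('v, 'e) path \<Rightarrow> ('v, 'e) path \<Rightarrow> bool) \<Rightarrow> bool" where
  "monomial_ordering Q lt \<longleftrightarrow>
    strict_total_on (paths Q) lt \<and>
    (\<forall>b1\<in>paths Q. \<forall>b2\<in>paths Q. \<forall>b\<in>paths Q. \<forall>b'\<in>paths Q.
       lt b2 b1 \<and> composable Q b1 b \<and> composable Q b2 b \<and>
       composable Q b' b1 \<and> composable Q b' b2 \<longrightarrow>
       lt (path_comp b2 b) (path_comp b1 b) \<and> lt (path_comp b' b2) (path_comp b' b1))"

locale path_algebra_quotient =
  quiver: fin_digraph Q +
  ring_hom_ring "path_algebra Q :: (('v, 'e) path \<Rightarrow>\<^sub>0 'k::field) ring" A psi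
  for Q :: "('v, 'e) pre_digraph" and A :: "('a, 'b) ring_scheme" (structure)
    and psi :: "(('v, 'e) path \<Rightarrow>\<^sub>0 'k::field) \<Rightarrow> 'a" +
  fixes less_P :: "('v, 'e) path \<Rightarrow> ('v, 'e) path \<Rightarrow> bool"
  assumes psi_surj: "psi ` carrier (path_algebra Q) = carrier A"
    and monomial_ordering_P: "monomial_ordering Q less_P"
begin

definition ker_psi :: "(('v, 'e) path \<Rightarrow>\<^sub>0 'k) set" where
  "ker_psi = a_kernel (path_algebra Q) A psi"

text \<open>The image of \<open>k \<cdot> 1\<close>, by which a scalar \<open>k\<close> acts on \<open>A\<close>.\<close>

definition scalar :: "'k \<Rightarrow> 'a" where
  "scalar k = psi (\<Sum>v\<in>verts Q. Poly_Mapping.single (v, []) k)"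

definition basic_algebra :: bool where
  "basic_algebra \<longleftrightarrow>
    ring.finite_dimension A (range scalar) (carrier A) \<and>
    (\<forall>p\<in>ker_psi. \<forall>b\<in>Poly_Mapping.keys p. 2 \<le> length (snd b))"

definition lm_P :: "(('v, 'e) path \<Rightarrow>\<^sub>0 'k) \<Rightarrow> ('v, 'e) path" where
  "lm_P p = greatest less_P (Poly_Mapping.keys p)"

definition std_mon :: "('v, 'e) path set" where
  "std_mon = paths Q - lm_P ` (ker_psi - {0})"

definition basis :: "'a set" where
  "basis = (\<lambda>u. psi (mono_of u)) ` std_mon"

definition lam :: "'a \<Rightarrow> ('v, 'e) path" where
  "lam b = (THE u. u \<in> std_mon \<and> psi (mono_of u) = b)"

definition less_A :: "'a \<Rightarrow> 'a \<Rightarrow> bool" where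
  "less_A b b' \<longleftrightarrow> less_P (lam b) (lam b')"

text \<open>
  \<open>basis\<close> is a \<open>K\<close>-basis of \<open>A\<close> indexed by \<open>std_mon\<close>: every element of \<open>A\<close> comes from exactly
  one linear combination of standard monomials. This can fail for finite-dimensional \<open>A\<close> when
  \<open>less_P\<close> is not well-founded (one loop \<open>x\<close> with \<open>x^2 = x^3\<close> and \<open>1 > x > x^2 > \<dots>\<close>), so it is
  a hypothesis below.
\<close>

definition std_mon_basis :: bool where
  "std_mon_basis \<longleftrightarrow> bij_betw psi {p. Poly_Mapping.keys p \<subseteq> std_mon} (carrier A)"

definition coeff_A :: "'a \<Rightarrow> 'a \<Rightarrow> 'k" where
  "coeff_A a b =
    Poly_Mapping.lookup (THE p. Poly_Mapping.keys p \<subseteq> std_mon \<and> psi p = a) (lam b)"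

definition lm_A :: "'a \<Rightarrow> 'a" where
  "lm_A a = greatest less_A {b\<in>basis. coeff_A a b \<noteq> 0}"

definition strictly_divides :: "'a \<Rightarrow> 'a \<Rightarrow> bool" where
  "strictly_divides b b' \<longleftrightarrow>
    (\<exists>d\<in>paths Q. composable Q (lam b) d \<and> lam b' = path_comp (lam b) d)"

definition toppling :: "'a \<Rightarrow> 'a \<Rightarrow> 'a \<Rightarrow> bool" where
  "toppling b t c \<longleftrightarrow> b \<in> basis \<and> c \<in> basis \<and>
    (b \<otimes> c \<noteq> \<zero> \<and> lm_A (b \<otimes> c) = t \<and> \<not> strictly_divides b t \<or> b \<otimes> c = \<zero> \<and> t = \<zero>)"

definition small_cofactor :: "'a \<Rightarrow> 'a \<Rightarrow> bool" where
  "small_cofactor b c \<longleftrightarrow> c \<in> basis \<and> \<not> (\<exists>t. toppling b t c)"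

definition minimal_toppling :: "'a \<Rightarrow> 'a \<Rightarrow> 'a \<Rightarrow> bool" where
  "minimal_toppling b t c \<longleftrightarrow> toppling b t c \<and>
    (\<forall>c'\<in>basis. strictly_divides c' c \<and> c' \<noteq> c \<longrightarrow> small_cofactor b c')"

definition module_monomials :: "nat \<Rightarrow> (nat \<times> 'a) set" where
  "module_monomials r = {..<r} \<times> basis"

definition module_ordering :: "nat \<Rightarrow> (nat \<times> 'a \<Rightarrow> nat \<times> 'a \<Rightarrow> bool) \<Rightarrow> bool" where
  "module_ordering r lt \<longleftrightarrow>
    strict_total_on (module_monomials r) lt \<and>
    (\<forall>i<r. \<forall>b1\<in>basis. \<forall>b2\<in>basis. less_A b2 b1 \<longrightarrow> lt (i, b2) (i, b1)) \<and>
    (\<forall>i<r. \<forall>j<r. \<forall>b1\<in>basis. \<forall>b2\<in>basis. \<forall>b\<in>basis.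
       small_cofactor b1 b \<and> lt (j, b2) (i, b1) \<longrightarrow>
       b2 \<otimes> b = \<zero> \<or> lt (j, lm_A (b2 \<otimes> b)) (i, lm_A (b1 \<otimes> b)))"

text \<open>
  Signatures are the monomials \<open>(i, b)\<close> of the free module over the path algebra, together with
  its generators \<open>(i, 1)\<close>. The latter are monomials only if the quiver has a single vertex.
\<close>

definition signatures :: "nat \<Rightarrow> (nat \<times> (('v, 'e) path \<Rightarrow>\<^sub>0 'k)) set" where
  "signatures m =
    {(i, mono_of b) |i b. i < m \<and> b \<in> paths Q} \<union> {(i, \<one>\<^bsub>path_algebra Q\<^esub>) |i. i < m}"

definition signature_ordering ::
  "nat \<Rightarrow> (nat \<times> (('v, 'e) path \<Rightarrow>\<^sub>0 'k) \<Rightarrow> nat \<times> (('v, 'e) path \<Rightarrow>\<^sub>0 'k) \<Rightarrow> bool) \<Rightarrow> bool" where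
  "signature_ordering m lt \<longleftrightarrow>
    strict_total_on (signatures m) lt \<and>
    (\<forall>i<m. \<forall>b1\<in>paths Q. \<forall>b2\<in>paths Q.
       less_P b2 b1 \<longrightarrow> lt (i, mono_of b2) (i, mono_of b1)) \<and>
    (\<forall>i<m. \<forall>j<m. \<forall>b1\<in>paths Q. \<forall>b2\<in>paths Q. \<forall>b\<in>paths Q.
       lt (j, mono_of b2) (i, mono_of b1) \<and> composable Q b1 b \<and> composable Q b2 b \<longrightarrow>
       lt (j, mono_of (path_comp b2 b)) (i, mono_of (path_comp b1 b)))"

end


section \<open>The F5 algorithm\<close>

type_synonym ('v, 'e, 'k) signature = "nat \<times> (('v, 'e) path \<Rightarrow>\<^sub>0 'k)"

type_synonym ('a, 'v, 'e, 'k) signed = "(nat \<Rightarrow> 'a) \<times> ('v, 'e, 'k) signature"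

type_synonym ('a, 'v, 'e, 'k) f5_state =
  "('a, 'v, 'e, 'k) signed set \<times> ('v, 'e, 'k) signature set"

datatype ('s, 'a) crit_pair = Pair_T 's 'a | Pair_S 's 's 'a

locale f5_setting = path_algebra_quotient Q A psi less_P
  for Q :: "('v, 'e) pre_digraph" and A :: "('a, 'b) ring_scheme" (structure)
    and psi :: "(('v, 'e) path \<Rightarrow>\<^sub>0 'k::field) \<Rightarrow> 'a"
    and less_P :: "('v, 'e) path \<Rightarrow> ('v, 'e) path \<Rightarrow> bool" +
  fixes r :: nat and less_F :: "nat \<times> 'a \<Rightarrow> nat \<times> 'a \<Rightarrow> bool"
    and m :: nat and less_E :: "('v, 'e, 'k) signature \<Rightarrow> ('v, 'e, 'k) signature \<Rightarrow> bool"
    and gens :: "nat \<Rightarrow> nat \<Rightarrow> 'a"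
  assumes std_mon_basis: "std_mon_basis"
    and module_ordering_F: "module_ordering r less_F"
    and signature_ordering_E: "signature_ordering m less_E"
    and gens_closed: "\<And>i. i < m \<Longrightarrow> gens i \<in> free_module A r"
begin

definition F_zero :: "nat \<Rightarrow> 'a" where
  "F_zero = (\<lambda>_. \<zero>)"

definition F_diff :: "(nat \<Rightarrow> 'a) \<Rightarrow> (nat \<Rightarrow> 'a) \<Rightarrow> nat \<Rightarrow> 'a" where
  "F_diff f g = (\<lambda>i. f i \<ominus> g i)"

definition F_scale :: "'k \<Rightarrow> (nat \<Rightarrow> 'a) \<Rightarrow> nat \<Rightarrow> 'a" where
  "F_scale k f = (\<lambda>i. scalar k \<otimes> f i)"

definition F_mult :: "(nat \<Rightarrow> 'a) \<Rightarrow> 'a \<Rightarrow> nat \<Rightarrow> 'a" where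
  "F_mult f a = (\<lambda>i. f i \<otimes> a)"

definition coeff_F :: "(nat \<Rightarrow> 'a) \<Rightarrow> nat \<times> 'a \<Rightarrow> 'k" where
  "coeff_F f x = coeff_A (f (fst x)) (snd x)"

definition lm_F :: "(nat \<Rightarrow> 'a) \<Rightarrow> nat \<times> 'a" where
  "lm_F f = greatest less_F {x\<in>module_monomials r. coeff_F f x \<noteq> 0}"

definition lc_F :: "(nat \<Rightarrow> 'a) \<Rightarrow> 'k" where
  "lc_F f = coeff_F f (lm_F f)"

definition small_cofactor_of_lm :: "(nat \<Rightarrow> 'a) \<Rightarrow> 'a \<Rightarrow> bool" where
  "small_cofactor_of_lm f c \<longleftrightarrow> small_cofactor (snd (lm_F f)) c"

definition sig_mult :: "('v, 'e, 'k) signature \<Rightarrow> 'a \<Rightarrow> ('v, 'e, 'k) signature" where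
  "sig_mult s c = gen_mult (path_algebra Q) s (mono_of (lam c))"

text \<open>
  A product of a signature with a path may vanish; \<open>0\<close> counts as smaller than every signature.
\<close>

definition sig_less :: "('v, 'e, 'k) signature \<Rightarrow> ('v, 'e, 'k) signature \<Rightarrow> bool" where
  "sig_less s' s \<longleftrightarrow> snd s' = 0 \<or> less_E s' s"

definition reducer ::
  "('a, 'v, 'e, 'k) signed set \<Rightarrow> ('v, 'e, 'k) signature \<Rightarrow> (nat \<Rightarrow> 'a) \<Rightarrow>
    ('a, 'v, 'e, 'k) signed \<Rightarrow> 'a \<Rightarrow> bool" where
  "reducer G s f g c \<longleftrightarrow> g \<in> G \<and> small_cofactor_of_lm (fst g) c \<and>
    gen_mult A (lm_F (fst g)) c = lm_F f \<and> sig_less (sig_mult (snd g) c) s"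

definition irreducible ::
  "('a, 'v, 'e, 'k) signed set \<Rightarrow> ('v, 'e, 'k) signature \<Rightarrow> (nat \<Rightarrow> 'a) \<Rightarrow> bool" where
  "irreducible G s f \<longleftrightarrow> f = F_zero \<or> \<not> (\<exists>g c. reducer G s f g c)"

subsection \<open>Normal forms and interreduction\<close>

definition nf_step ::
  "('a, 'v, 'e, 'k) signed set \<Rightarrow> ('v, 'e, 'k) signature \<Rightarrow> (nat \<Rightarrow> 'a) \<Rightarrow> (nat \<Rightarrow> 'a) \<Rightarrow> bool" where
  "nf_step G s f f' \<longleftrightarrow> f \<noteq> F_zero \<and>
    (\<exists>g c. reducer G s f g c \<and>
       f' = F_diff f (F_scale (lc_F f / lc_F (fst g)) (F_mult (fst g) c)))"

text \<open>
  The choices made by the procedures are not fixed, so their results are relations.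
\<close>

definition nf ::
  "('a, 'v, 'e, 'k) signed set \<Rightarrow> ('a, 'v, 'e, 'k) signed \<Rightarrow> ('a, 'v, 'e, 'k) signed \<Rightarrow> bool" where
  "nf G f f' \<longleftrightarrow> snd f' = snd f \<and> (nf_step G (snd f))\<^sup>*\<^sup>* (fst f) (fst f') \<and>
    \<not> (\<exists>h. nf_step G (snd f) (fst f') h)"

definition nf_halts :: "('a, 'v, 'e, 'k) signed set \<Rightarrow> ('a, 'v, 'e, 'k) signed \<Rightarrow> bool" where
  "nf_halts G f \<longleftrightarrow> halts_from (nf_step G (snd f)) (fst f)"

inductive interred_step ::
  "('a, 'v, 'e, 'k) f5_state \<Rightarrow> ('a, 'v, 'e, 'k) f5_state \<Rightarrow> bool" where
  reduce: "\<lbrakk>g \<in> G; nf (G - {g}) g g'; g' \<noteq> g; fst g' \<noteq> F_zero\<rbrakk> \<Longrightarrow>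
    interred_step (G, L) (insert g' (G - {g}), L)"
| zero_reduction: "\<lbrakk>g \<in> G; nf (G - {g}) g g'; g' \<noteq> g; fst g' = F_zero\<rbrakk> \<Longrightarrow>
    interred_step (G, L) (G - {g}, insert (snd g) L)"
| same_signature: "\<lbrakk>g \<in> G; g' \<in> G; g \<noteq> g'; small_cofactor_of_lm (fst g') c;
    gen_mult A (lm_F (fst g')) c = lm_F (fst g); sig_mult (snd g') c = snd g\<rbrakk> \<Longrightarrow>
    interred_step (G, L) (G - {g}, L)"

definition interred ::
  "('a, 'v, 'e, 'k) f5_state \<Rightarrow> ('a, 'v, 'e, 'k) f5_state \<Rightarrow> bool" where
  "interred S S' \<longleftrightarrow> interred_step\<^sup>*\<^sup>* S S' \<and> \<not> (\<exists>T. interred_step S' T)"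

definition interred_halts :: "('a, 'v, 'e, 'k) f5_state \<Rightarrow> bool" where
  "interred_halts S \<longleftrightarrow> halts_from interred_step S \<and>
    (\<forall>G L. interred_step\<^sup>*\<^sup>* S (G, L) \<longrightarrow> (\<forall>g\<in>G. nf_halts (G - {g}) g))"

subsection \<open>Critical pairs\<close>

primrec critical_pair ::
  "('a, 'v, 'e, 'k) signed set \<Rightarrow> (('a, 'v, 'e, 'k) signed, 'a) crit_pair \<Rightarrow> bool" where
  "critical_pair G (Pair_T g c) \<longleftrightarrow>
    g \<in> G \<and> (\<exists>t. minimal_toppling (snd (lm_F (fst g))) t c)"
| "critical_pair G (Pair_S g g' c) \<longleftrightarrow>
    g \<in> G \<and> g' \<in> G \<and> small_cofactor_of_lm (fst g) c \<and>
    lm_F (fst g') = gen_mult A (lm_F (fst g)) c \<and> less_E (snd g') (sig_mult (snd g) c)"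

primrec S_poly :: "(('a, 'v, 'e, 'k) signed, 'a) crit_pair \<Rightarrow> ('a, 'v, 'e, 'k) signed" where
  "S_poly (Pair_T g c) = (F_mult (fst g) c, sig_mult (snd g) c)"
| "S_poly (Pair_S g g' c) =
    (F_diff (F_mult (fst g) c) (F_scale (lc_F (fst g) / lc_F (fst g')) (fst g')),
     sig_mult (snd g) c)"

text \<open>
  The condition on \<open>(i, 1)\<close> treats a generator in \<open>L\<close> like a monomial \<open>(i, c')\<close> with empty \<open>c'\<close>.
\<close>

definition standard :: "('v, 'e, 'k) signature set \<Rightarrow> ('v, 'e, 'k) signature \<Rightarrow> bool" where
  "standard L s \<longleftrightarrow> (\<exists>i<m. \<exists>c\<in>std_mon. s = (i, mono_of c) \<and>
    (i, \<one>\<^bsub>path_algebra Q\<^esub>) \<notin> L \<and>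
    \<not> (\<exists>c'\<in>paths Q. \<exists>b\<in>paths Q. \<exists>d\<in>paths Q. (i, mono_of c') \<in> L \<and>
         composable Q b c' \<and> composable Q c' d \<and> c = path_comp b (path_comp c' d)))"

primrec normal ::
  "('a, 'v, 'e, 'k) signed set \<Rightarrow> ('v, 'e, 'k) signature set \<Rightarrow> (('a, 'v, 'e, 'k) signed, 'a) crit_pair \<Rightarrow> bool"
  where
  "normal G L (Pair_T g c) \<longleftrightarrow>
    standard L (sig_mult (snd g) c) \<and> irreducible G (snd g) (fst g)"
| "normal G L (Pair_S g g' c) \<longleftrightarrow>
    standard L (sig_mult (snd g) c) \<and> irreducible G (snd g) (fst g) \<and>
    irreducible G (snd g') (fst g')"

subsection \<open>The main loop\<close>

definition covered :: "('a, 'v, 'e, 'k) signed set \<Rightarrow> ('v, 'e, 'k) signature \<Rightarrow> bool" where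
  "covered G s \<longleftrightarrow> (\<exists>g\<in>G. \<exists>c. small_cofactor_of_lm (fst g) c \<and>
    sig_mult (snd g) c = s \<and> irreducible G s (F_mult (fst g) c))"

definition selectable :: "('a, 'v, 'e, 'k) f5_state \<Rightarrow> (('a, 'v, 'e, 'k) signed, 'a) crit_pair \<Rightarrow> bool" where
  "selectable S p \<longleftrightarrow> critical_pair (fst S) p \<and> normal (fst S) (snd S) p \<and>
    \<not> covered (fst S) (snd (S_poly p))"

inductive f5_step ::
  "('a, 'v, 'e, 'k) f5_state \<Rightarrow> ('a, 'v, 'e, 'k) f5_state \<Rightarrow> bool" where
  syzygy: "\<lbrakk>selectable (G, L) p; nf G (S_poly p) s; fst s = F_zero\<rbrakk> \<Longrightarrow>
    f5_step (G, L) (G, insert (snd s) L)"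
| new_element: "\<lbrakk>selectable (G, L) p; nf G (S_poly p) s; fst s \<noteq> F_zero;
    interred (insert s G, L) S'\<rbrakk> \<Longrightarrow>
    f5_step (G, L) S'"

text \<open>The generators that vanish have no leading monomial and are left out from the start.\<close>

definition initial_set :: "('a, 'v, 'e, 'k) signed set" where
  "initial_set = {(gens i, (i, \<one>\<^bsub>path_algebra Q\<^esub>)) |i. i < m \<and> gens i \<noteq> F_zero}"

text \<open>
  Whatever choices are made, neither the main loop nor any of the interreductions and normal
  form computations started on the way runs forever.
\<close>

definition f5_terminates :: bool where
  "f5_terminates \<longleftrightarrow>
    interred_halts (initial_set, {}) \<and>
    (\<forall>G0 L0. interred (initial_set, {}) (G0, L0) \<longrightarrow>
      halts_from f5_step (G0, {}) \<and>
      (\<forall>G L p. f5_step\<^sup>*\<^sup>* (G0, {}) (G, L) \<and> selectable (G, L) p \<longrightarrow>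
        nf_halts G (S_poly p) \<and>
        (\<forall>s. nf G (S_poly p) s \<and> fst s \<noteq> F_zero \<longrightarrow> interred_halts (insert s G, L))))"

end

end

theory Submission
  imports Defs
begin

text \<open>
  Call the pair of the leading monomial and the signature of a signed element its head. As \<open>A\<close>
  is finite-dimensional, it has only finitely many monomials (\<open>finite_std_mon\<close>), and all
  signatures that occur are generators \<open>e\<^sub>i\<close> or products \<open>e\<^sub>i c\<close> with a standard monomial \<open>c\<close>
  (\<open>sigs\<close>). So there are finitely many possible heads, and termination amounts to showing that
  the set of heads of \<open>G\<close> cannot change in a circle.

  Normal forms end because every step lowers the leading monomial (\<open>nf_step_less\<close>), and an
  interreduction ends because every step removes an element or lowers its leading monomial, so
  that a sum of ranks drops (\<open>interred_step_admissible\<close>).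

  For the main loop, let \<open>\<mu>\<close> divide \<open>\<nu>\<close> and write \<open>shift \<rho> \<mu> \<nu>\<close> for the product of the signature
  \<open>\<rho>\<close> with the path by which \<open>\<nu>\<close> exceeds \<open>\<mu>\<close>. A small cofactor \<open>c\<close> with \<open>\<mu> c = \<nu>\<close> need not be
  that path, because products in \<open>A\<close> are rewritten to standard monomials, but the path is the
  smallest one (\<open>shift_least\<close>, \<open>shift_attained\<close>). Reducibility is therefore a matter of heads
  alone: \<open>(\<nu>, \<sigma>)\<close> is reducible iff some head \<open>(\<mu>, \<rho>)\<close> has \<open>\<mu>\<close> dividing \<open>\<nu>\<close> and \<open>shift \<rho> \<mu> \<nu> <
  \<sigma>\<close>.

  Call \<open>(\<nu>, \<sigma>)\<close> essential if no head at a proper divisor \<open>\<mu>\<close> of \<open>\<nu>\<close> has \<open>shift \<rho> \<mu> \<nu> \<le> \<sigma>\<close>. For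
  each length \<open>n\<close> count the pairs \<open>(\<nu>, \<tau>)\<close> with \<open>\<nu>\<close> of length \<open>n\<close> such that no essential \<open>(\<nu>,
  \<sigma>)\<close> has \<open>\<sigma> \<le> \<tau>\<close>, and compare the sequences of these numbers lexicographically, short monomials
  first. This potential never rises:

  \<^item> Removing a head in favour of another one can only make further heads essential; if the
    removed head was itself essential, then an essential head of smaller signature at the same
    monomial remains (\<open>undominated_remove\<close>).

  \<^item> Inserting an irreducible head at \<open>\<nu>\<close> makes heads redundant only at monomials longer than
    \<open>\<nu>\<close>. It lowers the count at \<open>\<nu>\<close>, unless the new head is redundant with equality of
    signatures; then whatever it makes redundant was redundant before
    (\<open>undominated_insert_redundant\<close>).

  The element that the loop adds is irreducible and its signature was not covered, which
  excludes the equality, so the potential drops (\<open>potential_insert_less\<close>). A zero reduction of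
  an S-polynomial leaves \<open>G\<close> alone and moves one of the finitely many signatures into \<open>L\<close>.

  Two irregularities have to be taken care of. First, a product of a signature with a path can
  vanish although the product of the leading monomial does not, and then it counts as smaller
  than all signatures. Such a head reduces all others at its monomial; the invariant \<open>tame\<close> says
  that it also has the smallest signature there, which keeps the removal argument valid. Second,
  unless the quiver has only one vertex, a generator \<open>e\<^sub>i\<close> is not a monomial, and nothing ties
  its place in the order to that of the products \<open>e\<^sub>i c\<close>. But elements with such a signature are
  never added, only lowered or removed. Their weight is therefore put in front of the potential,
  and the potential is only compared while they stay unchanged.
\<close>


section \<open>Greatest elements and terminating relations\<close>

lemma strict_total_onD:
  assumes "strict_total_on T lt"
  shows "x \<in> T \<Longrightarrow> \<not> lt x x"
    and "x \<in> T \<Longrightarrow> y \<in> T \<Longrightarrow> z \<in> T \<Longrightarrow> lt x y \<Longrightarrow> lt y z \<Longrightarrow> lt x z"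
    and "x \<in> T \<Longrightarrow> y \<in> T \<Longrightarrow> x \<noteq> y \<Longrightarrow> lt x y \<or> lt y x"
  using assms unfolding strict_total_on_def irreflp_on_def transp_on_def totalp_on_def by metis+

lemma strict_total_on_inv_image:
  assumes "strict_total_on T lt" "inj_on f S" "f ` S \<subseteq> T"
  shows "strict_total_on S (\<lambda>x y. lt (f x) (f y))"
proof -
  have T: "f x \<in> T" if "x \<in> S" for x using assms(3) that by auto
  note T' = strict_total_onD[OF assms(1)]
  show ?thesis
    unfolding strict_total_on_def
  proof (intro conjI irreflp_onI transp_onI totalp_onI)
    show "\<not> lt (f x) (f x)" if "x \<in> S" for x using T'(1) T that by blast
    show "lt (f x) (f z)" if "x \<in> S" "y \<in> S" "z \<in> S" "lt (f x) (f y)" "lt (f y) (f z)" for x y z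
      using T'(2)[of "f x" "f y" "f z"] T that by blast
    show "lt (f x) (f y) \<or> lt (f y) (f x)" if "x \<in> S" "y \<in> S" "x \<noteq> y" for x y
      using T'(3)[of "f x" "f y"] T that assms(2) by (blast dest: inj_onD)
  qed
qed

lemma greatest_eqI:
  assumes "strict_total_on T lt" "S \<subseteq> T" "x \<in> S" "\<And>y. y \<in> S \<Longrightarrow> y \<noteq> x \<Longrightarrow> lt y x"
  shows "greatest lt S = x"
  unfolding greatest_def
proof (rule the_equality)
  fix z assume z: "z \<in> S \<and> (\<forall>y\<in>S. y \<noteq> z \<longrightarrow> lt y z)"
  show "z = x"
  proof (rule ccontr)
    assume "z \<noteq> x"
    with z assms(3,4) have "lt z x" "lt x z" by auto
    moreover have "z \<in> T" "x \<in> T" using z assms(2,3) by auto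
    ultimately show False using strict_total_onD(1,2)[OF assms(1)] by metis
  qed
qed (use assms in auto)

lemma
  assumes T: "strict_total_on T lt" and S: "finite S" "S \<noteq> {}" "S \<subseteq> T"
  shows greatest_in: "greatest lt S \<in> S"
    and less_greatest: "\<And>y. y \<in> S \<Longrightarrow> y \<noteq> greatest lt S \<Longrightarrow> lt y (greatest lt S)"
proof -
  have "\<exists>x\<in>S. \<forall>y\<in>S. y \<noteq> x \<longrightarrow> lt y x"
    using S
  proof (induction S rule: finite_ne_induct)
    case (insert a S)
    then obtain x where x: "x \<in> S" "\<forall>y\<in>S. y \<noteq> x \<longrightarrow> lt y x" by auto
    then show ?case
      using strict_total_onD(2,3)[OF T] insert.prems
      by (cases "lt a x") (metis insert_iff subsetD)+
  qed auto
  then obtain x where x: "x \<in> S" "\<And>y. y \<in> S \<Longrightarrow> y \<noteq> x \<Longrightarrow> lt y x" by blast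
  with greatest_eqI[OF T S(3)] have "greatest lt S = x" by blast
  with x show "greatest lt S \<in> S" "\<And>y. y \<in> S \<Longrightarrow> y \<noteq> greatest lt S \<Longrightarrow> lt y (greatest lt S)"
    by auto
qed

lemma halts_from_measure:
  assumes "wf R" "Inv x"
    and step: "\<And>x y. Inv x \<Longrightarrow> step x y \<Longrightarrow> Inv y \<and> (\<mu> y, \<mu> x) \<in> R"
  shows "halts_from step x"
  unfolding halts_from_def
proof
  assume "\<exists>X. X 0 = x \<and> (\<forall>n. step (X n) (X (Suc n)))"
  then obtain X where X: "X 0 = x" "\<And>n. step (X n) (X (Suc n))" by blast
  have "Inv (X n)" for n
    by (induction n) (use X assms in auto)
  with step X(2) have "(\<mu> (X (Suc n)), \<mu> (X n)) \<in> R" for n by blast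
  with \<open>wf R\<close> show False
    unfolding wf_iff_no_infinite_down_chain by (metis comp_apply)
qed

definition rank_in :: "('a \<Rightarrow> 'a \<Rightarrow> bool) \<Rightarrow> 'a set \<Rightarrow> 'a \<Rightarrow> nat" where
  "rank_in lt S x = card {y\<in>S. lt y x}"

lemma rank_in_less:
  assumes "strict_total_on S lt" "finite S" "x \<in> S" "y \<in> S" "lt x y"
  shows "rank_in lt S x < rank_in lt S y"
  unfolding rank_in_def
proof (rule psubset_card_mono)
  note T = strict_total_onD[OF assms(1)]
  have "{z \<in> S. lt z x} \<subseteq> {z \<in> S. lt z y}" using T(2)[of _ x y] assms by auto
  moreover have "x \<in> {z \<in> S. lt z y}" "x \<notin> {z \<in> S. lt z x}" using T(1)[of x] assms by auto
  ultimately show "{z \<in> S. lt z x} \<subset> {z \<in> S. lt z y}" by blast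
qed (use assms in simp)


section \<open>The descent of heads\<close>

lemma lex_map_upt:
  assumes "n < N" "f n < g n" "\<And>k. k < n \<Longrightarrow> f k = g k"
  shows "(map f [0..<N], map g [0..<N]) \<in> lex less_than"
proof -
  have "[0..<N] = [0..<n] @ n # [Suc n..<N]"
    using assms(1) upt_add_eq_append[of 0 n "N - n"] by (simp add: upt_conv_Cons)
  moreover have "map f [0..<n] = map g [0..<n]" using assms(3) by simp
  ultimately have "map f [0..<N] = map g [0..<n] @ f n # map f [Suc n..<N]"
    "map g [0..<N] = map g [0..<n] @ g n # map g [Suc n..<N]" by simp_all
  with assms(2) show ?thesis unfolding lex_conv by auto
qed

lemma lex_map_upt_le:
  assumes "\<And>n. f n \<le> g n"
  shows "map f [0..<N] = map g [0..<N] \<or> (map f [0..<N], map g [0..<N]) \<in> lex less_than"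
proof (cases "\<exists>n<N. f n \<noteq> g n")
  case True
  define n where "n = (LEAST n. n < N \<and> f n \<noteq> g n)"
  have n: "n < N" "f n \<noteq> g n"
    using LeastI_ex[OF True] by (simp_all add: n_def)
  have "f k = g k" if "k < n" for k
    using not_less_Least[of k "\<lambda>n. n < N \<and> f n \<noteq> g n"] that n(1) by (auto simp: n_def)
  with n assms[of n] lex_map_upt[of n N f g] show ?thesis by simp
qed simp

text \<open>
  The combinatorics of heads. \<open>N\<close> are the monomials, \<open>pre\<close> is divisibility, \<open>S\<close> are the
  signatures of heads and \<open>T\<close> is an ordered set with room for their products; \<open>shift \<rho> \<mu> \<nu>\<close>
  carries the signature \<open>\<rho>\<close> of an element at \<open>\<mu>\<close> along to \<open>\<nu>\<close>. Products may be \<open>zero\<close>; \<open>gen\<close>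
  marks the generators, whose product with a trivial path may be another signature.
\<close>
locale head_system =
  fixes N :: "'n set" and len :: "'n \<Rightarrow> nat" and pre :: "'n \<Rightarrow> 'n \<Rightarrow> bool"
    and S T :: "'s set" and less :: "'s \<Rightarrow> 's \<Rightarrow> bool" and zero gen :: "'s \<Rightarrow> bool"
    and shift :: "'s \<Rightarrow> 'n \<Rightarrow> 'n \<Rightarrow> 's"
  assumes finite_N: "finite N" and finite_S: "finite S" and S_T: "S \<subseteq> T"
    and less_total: "strict_total_on T less"
    and pre_refl: "\<nu> \<in> N \<Longrightarrow> pre \<nu> \<nu>"
    and pre_trans: "pre \<mu> \<nu> \<Longrightarrow> pre \<nu> \<kappa> \<Longrightarrow> pre \<mu> \<kappa>"
    and pre_len: "\<mu> \<in> N \<Longrightarrow> \<nu> \<in> N \<Longrightarrow> pre \<mu> \<nu> \<Longrightarrow> \<mu> \<noteq> \<nu> \<Longrightarrow> len \<mu> < len \<nu>"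
    and shift_closed: "\<rho> \<in> S \<Longrightarrow> \<mu> \<in> N \<Longrightarrow> \<nu> \<in> N \<Longrightarrow> pre \<mu> \<nu> \<Longrightarrow> zero (shift \<rho> \<mu> \<nu>) \<or> shift \<rho> \<mu> \<nu> \<in> T"
    and shift_shift: "\<rho> \<in> S \<Longrightarrow> \<mu> \<in> N \<Longrightarrow> \<nu> \<in> N \<Longrightarrow> \<kappa> \<in> N \<Longrightarrow> pre \<mu> \<nu> \<Longrightarrow> pre \<nu> \<kappa> \<Longrightarrow>
      shift (shift \<rho> \<mu> \<nu>) \<nu> \<kappa> = shift \<rho> \<mu> \<kappa>"
    and shift_refl: "\<rho> \<in> S \<Longrightarrow> \<not> gen \<rho> \<Longrightarrow> \<nu> \<in> N \<Longrightarrow> zero (shift \<rho> \<nu> \<nu>) \<or> shift \<rho> \<nu> \<nu> = \<rho>"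
begin

definition below :: "'s \<Rightarrow> 's \<Rightarrow> bool" where
  "below a b \<longleftrightarrow> zero a \<or> less a b"

text \<open>
  Generators are allowed to act at \<open>\<nu>\<close> itself: they stay fixed while potentials are compared, so
  they may be treated like elements at a shorter monomial.
\<close>
definition redundant :: "('n \<times> 's) set \<Rightarrow> 'n \<Rightarrow> 's \<Rightarrow> bool" where
  "redundant H \<nu> \<sigma> \<longleftrightarrow> (\<exists>\<mu> \<rho>. (\<mu>, \<rho>) \<in> H \<and> pre \<mu> \<nu> \<and> (\<mu> \<noteq> \<nu> \<or> gen \<rho>) \<and>
     (below (shift \<rho> \<mu> \<nu>) \<sigma> \<or> shift \<rho> \<mu> \<nu> = \<sigma>))"

definition essential :: "('n \<times> 's) set \<Rightarrow> 'n \<Rightarrow> 's \<Rightarrow> bool" where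
  "essential H \<nu> \<sigma> \<longleftrightarrow> (\<nu>, \<sigma>) \<in> H \<and> \<not> gen \<sigma> \<and> \<not> redundant H \<nu> \<sigma>"

text \<open>
  Recording the whole up-set of the smallest essential signature at \<open>\<nu>\<close>, rather than that
  signature, turns comparisons of minima into inclusions of finite sets.
\<close>
definition undominated :: "('n \<times> 's) set \<Rightarrow> nat \<Rightarrow> ('n \<times> 's) set" where
  "undominated H n = {(\<nu>, \<tau>) \<in> N \<times> S. len \<nu> = n \<and> \<not> (\<exists>\<rho>. essential H \<nu> \<rho> \<and> (\<rho> = \<tau> \<or> less \<rho> \<tau>))}"

text \<open>
  The sum of all lengths bounds each of them, so no length is left out.
\<close>
definition potential :: "('n \<times> 's) set \<Rightarrow> nat list" where
  "potential H = map (\<lambda>n. card (undominated H n)) [0..<Suc (\<Sum>\<nu>\<in>N. len \<nu>)]"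

text \<open>
  If the signature of a head is annihilated by the end vertex of its monomial, then the head
  reduces everything at that monomial, whatever the signatures are. It must not be larger than a
  head that it displaces.
\<close>
definition tame :: "('n \<times> 's) set \<Rightarrow> bool" where
  "tame H \<longleftrightarrow> H \<subseteq> N \<times> S \<and> (\<forall>\<nu> \<rho> \<sigma>. (\<nu>, \<rho>) \<in> H \<and> (\<nu>, \<sigma>) \<in> H \<and> \<not> gen \<rho> \<and> \<not> gen \<sigma> \<and> \<rho> \<noteq> \<sigma> \<and>
     zero (shift \<rho> \<nu> \<nu>) \<longrightarrow> less \<rho> \<sigma>)"

lemma finite_undominated: "finite (undominated H n)"
  by (rule finite_subset[of _ "N \<times> S"]) (auto simp: undominated_def finite_N finite_S)

lemma potential_mono:
  assumes "\<And>n. undominated H' n \<subseteq> undominated H n"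
  shows "potential H' = potential H \<or> (potential H', potential H) \<in> lex less_than"
  unfolding potential_def
  by (rule lex_map_upt_le) (use assms finite_undominated in \<open>blast intro: card_mono\<close>)

lemma potential_strict:
  assumes "\<nu> \<in> N" "undominated H' (len \<nu>) \<subset> undominated H (len \<nu>)"
    and "\<And>k. k < len \<nu> \<Longrightarrow> undominated H' k = undominated H k"
  shows "(potential H', potential H) \<in> lex less_than"
  unfolding potential_def
proof (rule lex_map_upt)
  show "len \<nu> < Suc (\<Sum>\<nu>\<in>N. len \<nu>)"
    using member_le_sum[OF assms(1), of len] finite_N by simp
qed (use assms finite_undominated in \<open>auto intro: psubset_card_mono\<close>)

lemma less_trans: "a \<in> T \<Longrightarrow> b \<in> T \<Longrightarrow> c \<in> T \<Longrightarrow> less a b \<Longrightarrow> less b c \<Longrightarrow> less a c"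
  using strict_total_onD(2)[OF less_total] .

lemma redundant_mono: "redundant H \<nu> \<sigma> \<Longrightarrow> H \<subseteq> H' \<Longrightarrow> redundant H' \<nu> \<sigma>"
  unfolding redundant_def by blast

lemma tame_subset: "tame H \<Longrightarrow> H' \<subseteq> H \<Longrightarrow> tame H'"
  unfolding tame_def by blast

text \<open>
  Redundancy at a fixed monomial is inherited by larger signatures. This makes the displacing
  head essential when the displaced one was.
\<close>
lemma redundant_less:
  assumes H: "H \<subseteq> N \<times> S" and "\<nu> \<in> N" "\<rho> \<in> S" "\<sigma> \<in> S" "redundant H \<nu> \<rho>" "less \<rho> \<sigma>"
  shows "redundant H \<nu> \<sigma>"
proof -
  obtain \<mu> \<pi> where m: "(\<mu>, \<pi>) \<in> H" "pre \<mu> \<nu>" "\<mu> \<noteq> \<nu> \<or> gen \<pi>"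
    "below (shift \<pi> \<mu> \<nu>) \<rho> \<or> shift \<pi> \<mu> \<nu> = \<rho>"
    using assms(5) unfolding redundant_def by blast
  have "zero (shift \<pi> \<mu> \<nu>) \<or> shift \<pi> \<mu> \<nu> \<in> T" using shift_closed m H assms(2) by blast
  then have "below (shift \<pi> \<mu> \<nu>) \<sigma>"
    using m(4) assms less_trans[of "shift \<pi> \<mu> \<nu>" \<rho> \<sigma>] S_T unfolding below_def by blast
  with m show ?thesis unfolding redundant_def by blast
qed

text \<open>
  An essential head can only be displaced by a non-generator at the same monomial. By tameness
  the displacing head has the smaller signature, and it is essential too, so what the removed
  head dominated is still dominated.
\<close>
lemma undominated_remove:
  assumes H: "tame H" and x: "(\<nu>, \<sigma>) \<in> H" and y: "(\<mu>, \<rho>) \<in> H" "(\<mu>, \<rho>) \<noteq> (\<nu>, \<sigma>)" "pre \<mu> \<nu>"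
    "below (shift \<rho> \<mu> \<nu>) \<sigma> \<or> shift \<rho> \<mu> \<nu> = \<sigma>"
  shows "undominated (H - {(\<nu>, \<sigma>)}) n \<subseteq> undominated H n"
proof -
  let ?H = "H - {(\<nu>, \<sigma>)}"
  have HNS: "H \<subseteq> N \<times> S" using H by (simp add: tame_def)
  have keep: "essential ?H \<kappa> \<pi>" if "essential H \<kappa> \<pi>" "(\<kappa>, \<pi>) \<noteq> (\<nu>, \<sigma>)" for \<kappa> \<pi>
    using that redundant_mono[of ?H] unfolding essential_def by blast
  have replace: "\<exists>\<pi>. essential ?H \<nu> \<pi> \<and> less \<pi> \<sigma>" if ess: "essential H \<nu> \<sigma>"
  proof -
    have \<mu>: "\<mu> = \<nu>" and \<rho>: "\<not> gen \<rho>" "\<rho> \<noteq> \<sigma>"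
      using ess y unfolding essential_def redundant_def by blast+
    have \<sigma>: "\<not> gen \<sigma>" using ess by (simp add: essential_def)
    have mem: "\<rho> \<in> S" "\<nu> \<in> N" "\<sigma> \<in> S" using HNS x y \<mu> by blast+
    have "less \<rho> \<sigma>"
    proof (cases "zero (shift \<rho> \<nu> \<nu>)")
      case True
      with H x y(1) \<mu> \<rho> \<sigma> show ?thesis unfolding tame_def by blast
    next
      case False
      with shift_refl[OF mem(1) \<rho>(1) mem(2)] y(4) \<rho>(2) \<mu> show ?thesis by (auto simp: below_def)
    qed
    moreover from this ess have "essential H \<nu> \<rho>"
      using y(1) \<mu> \<rho>(1) redundant_less[OF HNS mem(2,1,3)] unfolding essential_def by blast
    ultimately show ?thesis using keep[of \<nu> \<rho>] \<rho>(2) by blast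
  qed
  show ?thesis
  proof
    fix p assume p: "p \<in> undominated ?H n"
    obtain \<kappa> \<tau> where k: "p = (\<kappa>, \<tau>)" by (cases p)
    have kt: "\<kappa> \<in> N" "\<tau> \<in> S" "len \<kappa> = n" and none: "\<not> (\<exists>\<rho>. essential ?H \<kappa> \<rho> \<and> (\<rho> = \<tau> \<or> less \<rho> \<tau>))"
      using p unfolding k undominated_def by blast+
    have "\<not> (\<rho> = \<tau> \<or> less \<rho> \<tau>)" if ess: "essential H \<kappa> \<rho>" for \<rho>
    proof
      assume le: "\<rho> = \<tau> \<or> less \<rho> \<tau>"
      show False
      proof (cases "(\<kappa>, \<rho>) = (\<nu>, \<sigma>)")
        case True
        with replace ess obtain \<pi> where "essential ?H \<kappa> \<pi>" "less \<pi> \<rho>" by blast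
        moreover have "\<pi> \<in> T" "\<rho> \<in> T" "\<tau> \<in> T"
          using calculation ess HNS S_T kt unfolding essential_def by blast+
        ultimately show False using none le less_trans[of \<pi> \<rho> \<tau>] by blast
      qed (use keep ess none le in blast)
    qed
    with kt show "p \<in> undominated H n" unfolding k undominated_def by blast
  qed
qed

text \<open>
  If an irreducible head is redundant, then some \<open>(\<mu>, \<rho>)\<close> has \<open>shift \<rho> \<mu> \<nu> = \<sigma>\<close>, and by
  functoriality of \<open>shift\<close> the two act alike on all multiples of \<open>\<nu>\<close>. If it is not redundant,
  then it is a new essential head at \<open>\<nu>\<close>; no essential head there can have had a smaller
  signature, since it would have reduced the new one, and only longer monomials can suffer.
\<close>
lemma
  assumes H: "H \<subseteq> N \<times> S" and \<nu>: "\<nu> \<in> N" and \<sigma>: "\<sigma> \<in> S" "\<not> gen \<sigma>"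
    and irred: "\<And>\<mu> \<rho>. (\<mu>, \<rho>) \<in> H \<Longrightarrow> pre \<mu> \<nu> \<Longrightarrow> \<not> below (shift \<rho> \<mu> \<nu>) \<sigma>"
  shows undominated_insert_redundant:
      "redundant H \<nu> \<sigma> \<Longrightarrow> undominated (insert (\<nu>, \<sigma>) H) n = undominated H n"
    and potential_insert:
      "\<not> redundant H \<nu> \<sigma> \<Longrightarrow> (\<nu>, \<sigma>) \<notin> H \<Longrightarrow> (potential (insert (\<nu>, \<sigma>) H), potential H) \<in> lex less_than"
proof -
  let ?H = "insert (\<nu>, \<sigma>) H"
  show "undominated ?H n = undominated H n" if red: "redundant H \<nu> \<sigma>"
  proof -
    obtain \<mu> \<rho> where m: "(\<mu>, \<rho>) \<in> H" "pre \<mu> \<nu>" "\<mu> \<noteq> \<nu> \<or> gen \<rho>" "shift \<rho> \<mu> \<nu> = \<sigma>"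
      using red irred unfolding redundant_def by blast
    have mem: "\<mu> \<in> N" "\<rho> \<in> S" using m(1) H by blast+
    have "redundant H \<kappa> \<pi>" if "redundant ?H \<kappa> \<pi>" "\<kappa> \<in> N" for \<kappa> \<pi>
    proof (cases "pre \<nu> \<kappa> \<and> \<nu> \<noteq> \<kappa> \<and> (below (shift \<sigma> \<nu> \<kappa>) \<pi> \<or> shift \<sigma> \<nu> \<kappa> = \<pi>)")
      case True
      have "pre \<mu> \<kappa>" using pre_trans m(2) True by blast
      moreover have "\<mu> \<noteq> \<kappa>"
        using pre_len[OF mem(1) \<nu> m(2)] pre_len[OF \<nu> that(2)] True by force
      moreover have "shift \<rho> \<mu> \<kappa> = shift \<sigma> \<nu> \<kappa>"
        using shift_shift[OF mem(2,1) \<nu> that(2) m(2)] True m(4) by simp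
      ultimately show ?thesis using True m(1) unfolding redundant_def by metis
    next
      case False
      with that(1) \<sigma>(2) show ?thesis unfolding redundant_def by blast
    qed
    then have "redundant ?H \<kappa> \<pi> \<longleftrightarrow> redundant H \<kappa> \<pi>" if "\<kappa> \<in> N" for \<kappa> \<pi>
      using redundant_mono[of H \<kappa> \<pi> ?H] that by blast
    then have "essential ?H \<kappa> \<pi> \<longleftrightarrow> essential H \<kappa> \<pi>" if "\<kappa> \<in> N" for \<kappa> \<pi>
      using that red \<nu> unfolding essential_def by blast
    then show ?thesis unfolding undominated_def by blast
  qed
  show "(potential ?H, potential H) \<in> lex less_than" if nred: "\<not> redundant H \<nu> \<sigma>"
    and new: "(\<nu>, \<sigma>) \<notin> H"
  proof (rule potential_strict[OF \<nu>])
    have red: "redundant ?H \<kappa> \<pi> \<longleftrightarrow> redundant H \<kappa> \<pi>" if "\<kappa> \<in> N" "len \<kappa> \<le> len \<nu>" for \<kappa> \<pi>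
      using redundant_mono[of H \<kappa> \<pi> ?H] pre_len[OF \<nu> that(1)] that(2) \<sigma>(2)
      unfolding redundant_def by auto
    have ess: "essential ?H \<kappa> \<pi> \<longleftrightarrow> essential H \<kappa> \<pi> \<or> (\<kappa>, \<pi>) = (\<nu>, \<sigma>)" if "\<kappa> \<in> N" "len \<kappa> \<le> len \<nu>"
      for \<kappa> \<pi>
      using red[OF that] nred \<sigma>(2) unfolding essential_def by blast
    then show "undominated ?H k = undominated H k" if "k < len \<nu>" for k
      using that unfolding undominated_def by auto
    have "undominated ?H (len \<nu>) \<subseteq> undominated H (len \<nu>)"
      using ess unfolding undominated_def by auto
    moreover have "(\<nu>, \<sigma>) \<notin> undominated ?H (len \<nu>)"
      using ess[OF \<nu>] unfolding undominated_def by blast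
    moreover have "(\<nu>, \<sigma>) \<in> undominated H (len \<nu>)"
    proof -
      have False if "essential H \<nu> \<rho>" "\<rho> = \<sigma> \<or> less \<rho> \<sigma>" for \<rho>
      proof -
        have r: "(\<nu>, \<rho>) \<in> H" "\<not> gen \<rho>" using that(1) by (simp_all add: essential_def)
        with new that(2) have "less \<rho> \<sigma>" by blast
        moreover have "zero (shift \<rho> \<nu> \<nu>) \<or> shift \<rho> \<nu> \<nu> = \<rho>" using shift_refl r H by blast
        ultimately show False using irred[OF r(1) pre_refl[OF \<nu>]] by (auto simp: below_def)
      qed
      with \<nu> \<sigma> show ?thesis unfolding undominated_def by blast
    qed
    ultimately show "undominated ?H (len \<nu>) \<subset> undominated H (len \<nu>)" by blast
  qed
qed

text \<open>
  Whatever sits at \<open>\<nu>\<close> already does not reduce the new head, so it is not annihilated by the end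
  of \<open>\<nu>\<close> and has a larger signature.
\<close>
lemma tame_insert:
  assumes H: "tame H" and \<nu>: "\<nu> \<in> N" and \<sigma>: "\<sigma> \<in> S" "\<not> gen \<sigma>"
    and irred: "\<And>\<mu> \<rho>. (\<mu>, \<rho>) \<in> H \<Longrightarrow> pre \<mu> \<nu> \<Longrightarrow> \<not> below (shift \<rho> \<mu> \<nu>) \<sigma>"
  shows "tame (insert (\<nu>, \<sigma>) H)"
proof -
  have "\<not> zero (shift \<rho> \<nu> \<nu>) \<and> less \<sigma> \<rho>" if "(\<nu>, \<rho>) \<in> H" "\<not> gen \<rho>" "\<rho> \<noteq> \<sigma>" for \<rho>
  proof -
    have mem: "\<rho> \<in> S" using that(1) H unfolding tame_def by blast
    have "\<not> zero (shift \<rho> \<nu> \<nu>)" "\<not> less (shift \<rho> \<nu> \<nu>) \<sigma>"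
      using irred[OF that(1) pre_refl[OF \<nu>]] by (simp_all add: below_def)
    moreover from this have "shift \<rho> \<nu> \<nu> = \<rho>" using shift_refl mem that(2) \<nu> by blast
    ultimately show ?thesis
      using strict_total_onD(3)[OF less_total, of \<rho> \<sigma>] mem \<sigma>(1) that(3) S_T by auto
  qed
  with H \<nu> \<sigma> show ?thesis unfolding tame_def by auto
qed

end


section \<open>Coefficients in the quotient algebra\<close>

context wf_digraph
begin

lemma path_comp_trivial_right:
  "b \<in> paths G \<Longrightarrow>
    composable G b (path_end G b, []) \<and> path_comp b (path_end G b, []) = b"
  by (simp add: composable_def path_comp_def)

lemma path_comp_trivial_left:
  "b \<in> paths G \<Longrightarrow>
    composable G (fst b, []) b \<and> path_comp (fst b, []) b = b"
  by (simp add: composable_def path_comp_def path_end_def awalk_verts.simps)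

lemma path_end_trivial [simp]: "path_end G (v, []) = v"
  by (simp add: path_end_def awalk_verts.simps)

end

context f5_setting
begin

abbreviation P :: "(('v, 'e) path \<Rightarrow>\<^sub>0 'k) ring" where "P \<equiv> path_algebra Q"

lemma carrier_P [simp]: "p \<in> carrier P \<longleftrightarrow> Poly_Mapping.keys p \<subseteq> paths Q"
  by (simp add: path_algebra_def)

lemma P_simps [simp]: "mult P = path_mult Q" "add P = (+)" "\<zero>\<^bsub>P\<^esub> = 0"
  by (simp_all add: path_algebra_def fun_eq_iff)

lemma single_in_P: "b \<in> paths Q \<Longrightarrow> Poly_Mapping.single b k \<in> carrier P"
  by simp

lemma psi_simps:
  "psi 0 = \<zero>"
  "p \<in> carrier P \<Longrightarrow> q \<in> carrier P \<Longrightarrow> psi (p + q) = psi p \<oplus> psi q"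
  "p \<in> carrier P \<Longrightarrow> q \<in> carrier P \<Longrightarrow> psi (path_mult Q p q) = psi p \<otimes> psi q"
  using hom_zero hom_add[of p q] hom_mult[of p q] by simp_all

lemma psi_minus: "p \<in> carrier P \<Longrightarrow> q \<in> carrier P \<Longrightarrow> psi (p - q) = psi p \<ominus> psi q"
proof -
  assume pq: "p \<in> carrier P" "q \<in> carrier P"
  then have d: "p - q \<in> carrier P"
    using order.trans[OF keys_diff Un_least] by simp
  from pq d have "psi (p - q) \<oplus> psi q = psi p"
    by (simp add: psi_simps(2)[symmetric])
  moreover have "psi (p - q) \<in> carrier A" "psi q \<in> carrier A" using pq d hom_closed by blast+
  ultimately show ?thesis
    by (metis S.add.inv_closed S.add.inv_solve_right S.minus_eq hom_closed pq(1))
qed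

lemma std_mon_paths: "u \<in> std_mon \<Longrightarrow> u \<in> paths Q"
  by (simp add: std_mon_def)

lemma less_P_total: "strict_total_on (paths Q) less_P"
  using monomial_ordering_P by (simp add: monomial_ordering_def)

lemma ker_psi_iff: "p \<in> ker_psi \<longleftrightarrow> p \<in> carrier P \<and> psi p = \<zero>"
  unfolding ker_psi_def a_kernel_def' by simp

lemma
  assumes "p \<in> carrier P" "p \<noteq> 0"
  shows lm_P_in_keys: "lm_P p \<in> Poly_Mapping.keys p"
    and less_lm_P: "\<And>b. b \<in> Poly_Mapping.keys p \<Longrightarrow> b \<noteq> lm_P p \<Longrightarrow> less_P b (lm_P p)"
  using greatest_in[OF less_P_total, of "Poly_Mapping.keys p"]
    less_greatest[OF less_P_total, of "Poly_Mapping.keys p"] assms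
  by (simp_all add: lm_P_def)


text \<open>The coordinates of an element of \<open>A\<close> in the basis of standard monomials.\<close>
definition rep :: "'a \<Rightarrow> ('v, 'e) path \<Rightarrow>\<^sub>0 'k" where
  "rep a = (THE p. Poly_Mapping.keys p \<subseteq> std_mon \<and> psi p = a)"

lemma rep_eqI:
  assumes "Poly_Mapping.keys p \<subseteq> std_mon" "psi p = a"
  shows "rep a = p"
proof -
  have "inj_on psi {p. Poly_Mapping.keys p \<subseteq> std_mon}"
    using std_mon_basis by (simp add: std_mon_basis_def bij_betw_def)
  then have uniq: "q = p" if "Poly_Mapping.keys q \<subseteq> std_mon" "psi q = a" for q
    using that assms by (simp add: inj_on_def)
  show ?thesis
    unfolding rep_def by (rule the_equality) (simp add: assms, elim conjE, rule uniq)
qed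

lemma
  assumes "a \<in> carrier A"
  shows keys_rep: "Poly_Mapping.keys (rep a) \<subseteq> std_mon" and psi_rep: "psi (rep a) = a"
proof -
  have "a \<in> psi ` {p. Poly_Mapping.keys p \<subseteq> std_mon}"
    using assms std_mon_basis by (simp add: std_mon_basis_def bij_betw_def)
  then obtain p where "Poly_Mapping.keys p \<subseteq> std_mon" "psi p = a" by (elim imageE) simp
  with rep_eqI[OF this] show "Poly_Mapping.keys (rep a) \<subseteq> std_mon" "psi (rep a) = a" by simp_all
qed

lemma rep_in_P: "a \<in> carrier A \<Longrightarrow> rep a \<in> carrier P"
  using keys_rep[of a] std_mon_paths by (simp add: subset_iff)

lemma rep_zero [simp]: "rep \<zero> = 0"
  by (rule rep_eqI) (simp_all add: psi_simps)

lemma rep_add: "a \<in> carrier A \<Longrightarrow> b \<in> carrier A \<Longrightarrow> rep (a \<oplus> b) = rep a + rep b"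
  using order.trans[OF keys_add Un_least[OF keys_rep keys_rep]]
  by (intro rep_eqI) (simp_all add: psi_simps psi_rep rep_in_P del: carrier_P)

lemma rep_minus: "a \<in> carrier A \<Longrightarrow> b \<in> carrier A \<Longrightarrow> rep (a \<ominus> b) = rep a - rep b"
  using order.trans[OF keys_diff Un_least[OF keys_rep keys_rep]]
  by (intro rep_eqI) (simp_all add: psi_minus psi_rep rep_in_P del: carrier_P)

definition scalar_P :: "'k \<Rightarrow> ('v, 'e) path \<Rightarrow>\<^sub>0 'k" where
  "scalar_P k = (\<Sum>v\<in>verts Q. Poly_Mapping.single (v, []) k)"

lemma scalar_P_in_P: "scalar_P k \<in> carrier P"
proof -
  have "Poly_Mapping.keys (Poly_Mapping.single (v, []) k) \<subseteq> paths Q" if "v \<in> verts Q" for v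
    using that by (simp add: trivial_path)
  then show ?thesis
    unfolding scalar_P_def carrier_P by (intro order.trans[OF keys_sum] UN_least)
qed

lemma scalar_eq: "scalar k = psi (scalar_P k)"
  by (simp add: scalar_def scalar_P_def)

lemma scalar_closed: "scalar k \<in> carrier A"
  by (simp add: scalar_eq scalar_P_in_P del: carrier_P)

lemma lookup_scalar_P_mult:
  assumes "p \<in> carrier P"
  shows "Poly_Mapping.lookup (path_mult Q (scalar_P k) p) b = k * Poly_Mapping.lookup p b"
proof -
  have single: "path_mult Q (scalar_P k) (Poly_Mapping.single c x) = Poly_Mapping.single c (k * x)"
    if "c \<in> paths Q" for c x
    using quiver.path_ends_in_verts[OF that]
    by (simp add: scalar_P_def path_mult_sum_left path_mult_single composable_def path_comp_def
        quiver.path_end_trivial)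
  have "path_mult Q (scalar_P k) p =
      (\<Sum>c\<in>Poly_Mapping.keys p. Poly_Mapping.single c (k * Poly_Mapping.lookup p c))"
    by (subst (1) poly_mapping_sum_single[of p], subst path_mult_sum_right, rule sum.cong[OF refl])
      (use assms in \<open>simp only: carrier_P single subset_iff\<close>)
  then show ?thesis
    by (simp add: lookup_sum lookup_single when_def in_keys_iff)
qed

lemma lookup_rep_scale:
  assumes "a \<in> carrier A"
  shows "Poly_Mapping.lookup (rep (scalar k \<otimes> a)) b = k * Poly_Mapping.lookup (rep a) b"
proof -
  let ?q = "path_mult Q (scalar_P k) (rep a)"
  note l = lookup_scalar_P_mult[OF rep_in_P[OF assms]]
  have "rep (scalar k \<otimes> a) = ?q"
  proof (rule rep_eqI)
    show "Poly_Mapping.keys ?q \<subseteq> std_mon"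
      using keys_rep[OF assms] l by (simp add: in_keys_iff subset_iff)
    show "psi ?q = scalar k \<otimes> a"
      by (simp add: psi_simps scalar_P_in_P rep_in_P assms scalar_eq psi_rep del: carrier_P)
  qed
  with l show ?thesis by simp
qed

subsection \<open>Monomials of the quotient\<close>

lemma rep_psi_mono: "u \<in> std_mon \<Longrightarrow> rep (psi (mono_of u)) = mono_of u"
  by (rule rep_eqI) simp_all

lemma lam_psi: "u \<in> std_mon \<Longrightarrow> lam (psi (mono_of u)) = u"
  unfolding lam_def
proof (rule the_equality)
  fix w assume "u \<in> std_mon" "w \<in> std_mon \<and> psi (mono_of w) = psi (mono_of u)"
  then have "(mono_of w :: _ \<Rightarrow>\<^sub>0 'k) = mono_of u" using rep_psi_mono by metis
  then have "Poly_Mapping.keys (mono_of w :: _ \<Rightarrow>\<^sub>0 'k) = Poly_Mapping.keys (mono_of u :: _ \<Rightarrow>\<^sub>0 'k)"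
    by simp
  then show "w = u" by simp
qed simp

lemma psi_in_basis: "u \<in> std_mon \<Longrightarrow> psi (mono_of u) \<in> basis"
  by (simp add: basis_def)

lemma
  assumes "b \<in> basis"
  shows lam_std: "lam b \<in> std_mon" and psi_lam: "psi (mono_of (lam b)) = b"
    and rep_basis: "rep b = mono_of (lam b)"
proof -
  obtain u where "u \<in> std_mon" "b = psi (mono_of u)"
    using assms unfolding basis_def by (elim imageE) simp
  then show "lam b \<in> std_mon" "psi (mono_of (lam b)) = b" "rep b = mono_of (lam b)"
    using lam_psi rep_psi_mono by simp_all
qed

lemma lam_path: "b \<in> basis \<Longrightarrow> lam b \<in> paths Q"
  by (simp add: lam_std std_mon_paths)

lemma inj_lam: "inj_on lam basis"
  by (metis inj_onI psi_lam)

lemma basis_closed: "b \<in> basis \<Longrightarrow> b \<in> carrier A"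
  using hom_closed[OF single_in_P[OF lam_path]] psi_lam by metis

lemma basis_nonzero: "b \<in> basis \<Longrightarrow> b \<noteq> \<zero>"
  using rep_basis[of b] rep_zero by (metis keys_eq_empty keys_single insert_not_empty zero_neq_one)

lemma less_A_total: "strict_total_on basis less_A"
  using strict_total_on_inv_image[OF less_P_total inj_lam image_subsetI[OF lam_path]]
  by (simp add: less_A_def[abs_def])

lemma coeff_A_eq: "coeff_A a b = Poly_Mapping.lookup (rep a) (lam b)"
  by (simp add: coeff_A_def rep_def)

lemma coeff_A_basis: "b \<in> basis \<Longrightarrow> b' \<in> basis \<Longrightarrow> coeff_A b b' = (if b' = b then 1 else 0)"
  using inj_on_eq_iff[OF inj_lam, of b b']
  by (simp add: coeff_A_eq rep_basis lookup_single when_def eq_commute)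

lemma coeff_A_zero [simp]: "coeff_A \<zero> b = 0"
  by (simp add: coeff_A_eq)

lemma coeff_A_diff:
  "a \<in> carrier A \<Longrightarrow> a' \<in> carrier A \<Longrightarrow> coeff_A (a \<ominus> a') b = coeff_A a b - coeff_A a' b"
  by (simp add: coeff_A_eq rep_minus lookup_minus)

lemma coeff_A_scale: "a \<in> carrier A \<Longrightarrow> coeff_A (scalar k \<otimes> a) b = k * coeff_A a b"
  by (simp add: coeff_A_eq lookup_rep_scale)

lemma finite_support: "finite {b \<in> basis. coeff_A a b \<noteq> 0}"
proof -
  have "lam ` {b \<in> basis. coeff_A a b \<noteq> 0} \<subseteq> Poly_Mapping.keys (rep a)"
    by (simp add: coeff_A_eq in_keys_iff image_subset_iff)
  then have "finite (lam ` {b \<in> basis. coeff_A a b \<noteq> 0})"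
    by (rule finite_subset) simp
  then show ?thesis
    by (rule finite_imageD) (rule inj_on_subset[OF inj_lam], simp)
qed

lemma eq_zero_if_coeffs_zero:
  assumes "a \<in> carrier A" "\<And>b. b \<in> basis \<Longrightarrow> coeff_A a b = 0"
  shows "a = \<zero>"
proof -
  have "Poly_Mapping.lookup (rep a) u = 0" for u
  proof (cases "u \<in> std_mon")
    case True
    then show ?thesis
      using assms(2)[OF psi_in_basis] lam_psi by (simp add: coeff_A_eq)
  next
    case False
    then show ?thesis
      using keys_rep[OF assms(1)] in_keys_iff[of u "rep a"] by blast
  qed
  then have "rep a = 0" by (intro poly_mapping_eqI) simp
  then show ?thesis using psi_rep[OF assms(1)] by (simp add: psi_simps)
qed

lemma
  assumes "a \<in> carrier A" "a \<noteq> \<zero>"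
  shows lm_A_in_basis: "lm_A a \<in> basis"
    and less_lm_A: "\<And>b. b \<in> basis \<Longrightarrow> coeff_A a b \<noteq> 0 \<Longrightarrow> b \<noteq> lm_A a \<Longrightarrow> less_A b (lm_A a)"
proof -
  let ?S = "{b \<in> basis. coeff_A a b \<noteq> 0}"
  have ne: "?S \<noteq> {}" using eq_zero_if_coeffs_zero[OF assms(1)] assms(2) by blast
  have sub: "?S \<subseteq> basis" by simp
  show "lm_A a \<in> basis"
    using greatest_in[OF less_A_total finite_support ne sub] by (simp add: lm_A_def)
  show "less_A b (lm_A a)" if "b \<in> basis" "coeff_A a b \<noteq> 0" "b \<noteq> lm_A a" for b
    using less_greatest[OF less_A_total finite_support ne sub, of b] that by (simp add: lm_A_def)
qed

lemma lm_A_basis: "b \<in> basis \<Longrightarrow> lm_A b = b"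
  unfolding lm_A_def
proof (rule greatest_eqI[OF less_A_total])
  fix y assume "b \<in> basis" "y \<in> {b' \<in> basis. coeff_A b b' \<noteq> 0}" "y \<noteq> b"
  then show "less_A y b" using coeff_A_basis[of b y] by simp
qed (simp_all add: coeff_A_basis)

end


section \<open>Divisibility of monomials and small cofactors\<close>

context f5_setting
begin

lemma less_P_comp_left:
  assumes "b \<in> paths Q" "c \<in> paths Q" "d \<in> paths Q" "composable Q b c"
    and "fst c = fst d" "path_end Q c = path_end Q d" "less_P c d"
  shows "less_P (path_comp b c) (path_comp b d)"
proof -
  let ?e = "(path_end Q d, [])"
  have "?e \<in> paths Q" by (rule trivial_path) (simp add: quiver.path_ends_in_verts assms(3))
  moreover have "composable Q b d" "composable Q c ?e" "composable Q d ?e"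
    using assms by (simp_all add: composable_def)
  ultimately show ?thesis
    using monomial_ordering_P assms unfolding monomial_ordering_def by blast
qed

lemma path_comp_cancel:
  "composable Q b c \<Longrightarrow> composable Q b d \<Longrightarrow> path_comp b c = path_comp b d \<Longrightarrow> c = d"
  by (cases c, cases d) (simp add: composable_def path_comp_def)

text \<open>
  If \<open>d\<close> were the leading monomial of an element \<open>p\<close> of the kernel, then \<open>b d\<close> would be the
  leading monomial of an element of the kernel as well, namely of \<open>b p e\<close> with \<open>e\<close> the trivial
  path at the end of \<open>d\<close>. The factor \<open>e\<close> discards the terms of \<open>p\<close> that end elsewhere, to which
  the compatibility of the ordering does not apply.
\<close>
lemma std_mon_suffix:
  assumes b: "b \<in> paths Q" and d: "d \<in> paths Q" and bd: "composable Q b d" "path_comp b d \<in> std_mon"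
  shows "d \<in> std_mon"
proof (rule ccontr)
  assume "d \<notin> std_mon"
  then have "d \<in> lm_P ` (ker_psi - {0})" using d by (simp add: std_mon_def)
  then obtain p where p: "p \<in> ker_psi" "p \<noteq> 0" "d = lm_P p" by (elim imageE) blast
  have pP: "p \<in> carrier P" and p0: "psi p = \<zero>" using p(1) by (simp_all add: ker_psi_iff)
  let ?e = "(path_end Q d, [])"
  have e: "?e \<in> paths Q" by (rule trivial_path) (simp add: quiver.path_ends_in_verts d)
  define K where "K = {c \<in> Poly_Mapping.keys p. composable Q b c \<and> path_end Q c = path_end Q d}"
  define q where "q = path_mult Q (mono_of b) (path_mult Q p (mono_of ?e))"
  have K_paths: "c \<in> paths Q" if "c \<in> K" for c
    using that pP subsetD[of "Poly_Mapping.keys p" "paths Q" c] by (simp add: K_def)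
  have "q = (\<Sum>c\<in>Poly_Mapping.keys p. path_mult Q (mono_of b)
      (path_mult Q (Poly_Mapping.single c (Poly_Mapping.lookup p c)) (mono_of ?e)))"
    unfolding q_def
    by (subst (1) poly_mapping_sum_single[of p]) (simp add: path_mult_sum_left path_mult_sum_right)
  also have "\<dots> = (\<Sum>c\<in>Poly_Mapping.keys p. if composable Q b c \<and> path_end Q c = path_end Q d
      then Poly_Mapping.single (path_comp b c) (Poly_Mapping.lookup p c) else 0)"
    by (rule sum.cong[OF refl]) (simp add: path_mult_single composable_def path_comp_def)
  also have "\<dots> = (\<Sum>c\<in>K. Poly_Mapping.single (path_comp b c) (Poly_Mapping.lookup p c))"
    unfolding K_def by (rule sum.inter_filter[symmetric]) simp
  finally have q: "q = (\<Sum>c\<in>K. Poly_Mapping.single (path_comp b c) (Poly_Mapping.lookup p c))" .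
  have finK: "finite K" unfolding K_def by simp
  have dK: "d \<in> K" using p(3) lm_P_in_keys[OF pP p(2)] bd(1) by (simp add: K_def)
  have "Poly_Mapping.lookup q (path_comp b d) =
      (\<Sum>c\<in>K. if c = d then Poly_Mapping.lookup p c else 0)"
    unfolding q lookup_sum
  proof (rule sum.cong[OF refl])
    fix c assume "c \<in> K"
    then have "path_comp b c = path_comp b d \<longleftrightarrow> c = d"
      using path_comp_cancel[of b c d] bd(1) by (simp add: K_def) metis
    then show "Poly_Mapping.lookup (Poly_Mapping.single (path_comp b c) (Poly_Mapping.lookup p c))
        (path_comp b d) = (if c = d then Poly_Mapping.lookup p c else 0)"
      by (simp add: lookup_single when_def)
  qed
  also have "\<dots> = Poly_Mapping.lookup p d" using finK dK by (simp add: sum.delta)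
  also have "\<dots> \<noteq> 0" using p(3) lm_P_in_keys[OF pP p(2)] by (simp add: in_keys_iff)
  finally have key: "path_comp b d \<in> Poly_Mapping.keys q" by (simp add: in_keys_iff)
  have keys: "\<exists>c\<in>K. u = path_comp b c" if "u \<in> Poly_Mapping.keys q" for u
  proof -
    have "u \<in> (\<Union>c\<in>K. Poly_Mapping.keys (Poly_Mapping.single (path_comp b c)
      (Poly_Mapping.lookup p c)))"
      using that unfolding q by (rule subsetD[OF keys_sum])
    then obtain c where c: "c \<in> K"
        "u \<in> Poly_Mapping.keys (Poly_Mapping.single (path_comp b c) (Poly_Mapping.lookup p c))"
      by (rule UN_E)
    then have "u = path_comp b c" by (simp split: if_splits)
    with c(1) show ?thesis by (rule rev_bexI)
  qed
  have qP: "q \<in> carrier P"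
    unfolding carrier_P
  proof
    fix u assume "u \<in> Poly_Mapping.keys q"
    then obtain c where "c \<in> K" "u = path_comp b c" using keys by metis
    then show "u \<in> paths Q"
      using quiver.path_comp_in_paths[OF b] K_paths by (simp add: K_def)
  qed
  have "psi q = psi (mono_of b) \<otimes> (psi p \<otimes> psi (mono_of ?e))"
    unfolding q_def
  proof (subst psi_simps(3))
    show "path_mult Q p (mono_of ?e) \<in> carrier P"
      using R.m_closed[OF pP single_in_P[OF e]] unfolding P_simps .
    show "psi (mono_of b) \<otimes> psi (path_mult Q p (mono_of ?e)) = psi (mono_of b) \<otimes>
      (psi p \<otimes> psi (mono_of ?e))"
      using psi_simps(3)[OF pP single_in_P[OF e]] by simp
  qed (use b in simp)
  also have "\<dots> = \<zero>" using p0 hom_closed[OF single_in_P[OF e]] hom_closed[OF single_in_P[OF b]]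
    by simp
  finally have "q \<in> ker_psi" using qP by (simp add: ker_psi_iff)
  moreover have "q \<noteq> 0" using key by (metis keys_zero empty_iff)
  moreover have "lm_P q = path_comp b d"
    unfolding lm_P_def
  proof (rule greatest_eqI[OF less_P_total _ key])
    show "Poly_Mapping.keys q \<subseteq> paths Q" using qP by simp
    fix u assume u: "u \<in> Poly_Mapping.keys q" "u \<noteq> path_comp b d"
    then obtain c where c: "c \<in> K" "u = path_comp b c" using keys by metis
    then have "less_P c d"
      using less_lm_P[OF pP p(2), of c] u(2) p(3) by (simp add: K_def, metis)
    then show "less_P u (path_comp b d)"
      unfolding c(2) using less_P_comp_left[OF b K_paths[OF c(1)] d] c(1) bd(1)
      by (simp add: K_def composable_def)
  qed
  ultimately have "path_comp b d \<in> lm_P ` (ker_psi - {0})" by (metis image_eqI Diff_iff singletonD)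
  with bd(2) show False by (simp add: std_mon_def)
qed

lemma basis_mult:
  assumes "b \<in> basis" "c \<in> basis"
  shows "b \<otimes> c =
    (if composable Q (lam b) (lam c) then psi (mono_of (path_comp (lam b) (lam c))) else \<zero>)"
proof -
  have "b \<otimes> c = psi (path_mult Q (mono_of (lam b)) (mono_of (lam c)))"
    using psi_simps(3)[OF single_in_P[OF lam_path] single_in_P[OF lam_path], OF assms] psi_lam
      assms by simp
  then show ?thesis by (simp add: path_mult_single psi_simps)
qed

lemma psi_mult_trivial:
  assumes "u \<in> paths Q" "v \<in> verts Q"
  shows "psi (mono_of u) \<otimes> psi (mono_of (v, [])) =
    (if path_end Q u = v then psi (mono_of u) else \<zero>)"
  using psi_simps(3)[OF single_in_P[OF assms(1)] single_in_P[OF trivial_path[OF assms(2)]], of 1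
    1, symmetric]
  by (simp add: path_mult_single composable_def path_comp_def psi_simps)

text \<open>
  If the path \<open>lam b \<cdot> lam c\<close> differs from \<open>lam t\<close>, then their difference lies in the kernel,
  and since \<open>lam t\<close> is standard, its leading monomial is \<open>lam b \<cdot> lam c\<close>. So \<open>lam b \<cdot> d\<close> is the
  smaller of the two paths, and cancelling \<open>lam b\<close> compares \<open>d\<close> with \<open>lam c\<close>.
\<close>
lemma cofactor_ge_quotient:
  assumes b: "b \<in> basis" "c \<in> basis" "t \<in> basis" "b \<otimes> c = t"
    and d: "d \<in> paths Q" "composable Q (lam b) d" "lam t = path_comp (lam b) d"
  shows "fst d = fst (lam c) \<and> path_end Q d = path_end Q (lam c) \<and> (d = lam c \<or> less_P d (lam c))"
proof -
  let ?u = "path_comp (lam b) (lam c)"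
  have comp: "composable Q (lam b) (lam c)" and t: "psi (mono_of ?u) = t"
    using basis_mult[OF b(1,2)] b(4) basis_nonzero[OF b(3)] by (simp_all split: if_splits)
  have u: "?u \<in> paths Q" using quiver.path_comp_in_paths lam_path b(1,2) comp by simp
  (* multiplication by the trivial path at the end of lam c fixes t, so t ends there as well *)
  let ?w = "path_end Q (lam c)"
  have w: "?w \<in> verts Q" using quiver.path_ends_in_verts lam_path[OF b(2)] by blast
  have "path_end Q (lam t) = ?w"
    using psi_mult_trivial[OF u w] psi_mult_trivial[OF lam_path[OF b(3)] w] path_end_comp[OF comp]
      t psi_lam[OF b(3)] basis_nonzero[OF b(3)] by (simp split: if_splits)
  then have end_d: "path_end Q d = ?w" using path_end_comp[OF d(2)] d(3) by simp
  have fst_d: "fst d = fst (lam c)" using comp d(2) by (simp add: composable_def)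
  have "d = lam c \<or> less_P d (lam c)"
  proof (cases "?u = lam t")
    case True
    then show ?thesis using path_comp_cancel[OF comp d(2)] d(3) by simp
  next
    case False
    let ?p = "mono_of ?u - mono_of (lam t) :: ('v, 'e) path \<Rightarrow>\<^sub>0 'k"
    have keys: "Poly_Mapping.keys ?p = {?u, lam t}"
      by (rule Set.set_eqI) (use False in \<open>auto simp: in_keys_iff lookup_minus lookup_single
        when_def\<close>)
    have pP: "?p \<in> carrier P" unfolding carrier_P keys using u lam_path[OF b(3)] by simp
    have "psi ?p = \<zero>"
      using psi_minus[OF single_in_P[OF u] single_in_P[OF lam_path[OF b(3)]], of 1 1] t
        psi_lam[OF b(3)]
        basis_closed[OF b(3)] by (simp add: S.minus_eq S.r_neg)
    then have ker: "?p \<in> ker_psi" using pP by (simp add: ker_psi_iff)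
    have ne: "?p \<noteq> 0" using keys by (metis keys_zero insert_not_empty)
    have "lm_P ?p \<noteq> lam t"
    proof
      assume "lm_P ?p = lam t"
      then have "lam t \<in> lm_P ` (ker_psi - {0})" using ker ne
        by (metis image_eqI Diff_iff singletonD)
      then show False using lam_std[OF b(3)] by (simp add: std_mon_def)
    qed
    then have "less_P (lam t) ?u"
      using lm_P_in_keys[OF pP ne] less_lm_P[OF pP ne, of "lam t"] unfolding keys by simp
    moreover have False if "less_P (lam c) d"
    proof -
      have "less_P ?u (lam t)"
        using less_P_comp_left[OF lam_path[OF b(1)] lam_path[OF b(2)] d(1) comp] fst_d end_d that
          d(3) by simp
      with \<open>less_P (lam t) ?u\<close> show False
        using strict_total_onD(1,2)[OF less_P_total] u lam_path[OF b(3)] by metis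
    qed
    ultimately show ?thesis
      using strict_total_onD(3)[OF less_P_total d(1) lam_path[OF b(2)]] by metis
  qed
  with fst_d end_d show ?thesis by simp
qed

text \<open>
  The path \<open>d\<close> with \<open>lam t = lam b \<cdot> d\<close>, meant for \<open>b\<close> that strictly divides \<open>t\<close>.
\<close>
definition quotient :: "'a \<Rightarrow> 'a \<Rightarrow> ('v, 'e) path" where
  "quotient b t = (path_end Q (lam b), drop (length (snd (lam b))) (snd (lam t)))"

lemma
  assumes "strictly_divides b t"
  shows quotient_path: "quotient b t \<in> paths Q"
    and composable_quotient: "composable Q (lam b) (quotient b t)"
    and lam_quotient: "lam t = path_comp (lam b) (quotient b t)"
proof -
  obtain d where d: "d \<in> paths Q" "composable Q (lam b) d" "lam t = path_comp (lam b) d"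
    using assms unfolding strictly_divides_def by (elim bexE) simp
  then have "quotient b t = d" by (cases d) (simp add: quotient_def composable_def path_comp_def)
  with d show "quotient b t \<in> paths Q" "composable Q (lam b) (quotient b t)"
    "lam t = path_comp (lam b) (quotient b t)" by simp_all
qed

text \<open>
  Suffixes of standard monomials are standard, so the quotient path is itself a monomial of \<open>A\<close>,
  and it is a small cofactor that takes \<open>b\<close> to \<open>t\<close>.
\<close>
lemma
  assumes bt: "b \<in> basis" "t \<in> basis" "strictly_divides b t"
  shows lam_psi_quotient: "lam (psi (mono_of (quotient b t))) = quotient b t"
    and mult_quotient: "b \<otimes> psi (mono_of (quotient b t)) = t"
    and small_cofactor_quotient: "small_cofactor b (psi (mono_of (quotient b t)))"
proof -
  note q = quotient_path[OF bt(3)] composable_quotient[OF bt(3)] lam_quotient[OF bt(3)]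
  have std: "quotient b t \<in> std_mon"
    using std_mon_suffix[OF lam_path[OF bt(1)] q(1,2)] q(3) lam_std[OF bt(2)] by simp
  show l: "lam (psi (mono_of (quotient b t))) = quotient b t" using lam_psi[OF std] .
  show m: "b \<otimes> psi (mono_of (quotient b t)) = t"
    unfolding basis_mult[OF bt(1) psi_in_basis[OF std]] l
    using q(2) psi_lam[OF bt(2)] by (simp add: q(3)[symmetric])
  show "small_cofactor b (psi (mono_of (quotient b t)))"
    unfolding small_cofactor_def toppling_def m lm_A_basis[OF bt(2)]
    using psi_in_basis[OF std] basis_nonzero[OF bt(2)] bt(3) by simp
qed

lemma small_cofactor_divides:
  assumes "b \<in> basis" "small_cofactor b c" "b \<otimes> c = t" "t \<in> basis"
  shows "strictly_divides b t"
proof -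
  have "\<not> toppling b t c" "c \<in> basis" using assms(2) by (simp_all add: small_cofactor_def)
  then show ?thesis
    using assms basis_nonzero[OF assms(4)] by (simp add: toppling_def lm_A_basis)
qed

section \<open>Signatures\<close>

definition sig_times :: "('v, 'e, 'k) signature \<Rightarrow> ('v, 'e) path \<Rightarrow> ('v, 'e, 'k) signature" where
  "sig_times s u = gen_mult P s (mono_of u)"

lemma sig_mult_eq: "sig_mult s c = sig_times s (lam c)"
  by (simp add: sig_mult_def sig_times_def)

lemma sig_times_mono_of:
  "sig_times (i, mono_of p) u = (i, if composable Q p u then mono_of (path_comp p u) else 0)"
  by (simp add: sig_times_def gen_mult_def path_mult_single)

lemma sig_times_one: "u \<in> paths Q \<Longrightarrow> sig_times (i, \<one>\<^bsub>P\<^esub>) u = (i, mono_of u)"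
  using R.l_one[OF single_in_P, of u 1] by (simp add: sig_times_def gen_mult_def)

lemma signatures_cases:
  assumes "s \<in> signatures m"
  obtains i b where "i < m" "b \<in> paths Q" "s = (i, mono_of b)" | i where "i < m" "s = (i, \<one>\<^bsub>P\<^esub>)"
  using assms unfolding signatures_def by (elim UnE CollectE exE conjE) simp_all

lemma mono_of_signature: "i < m \<Longrightarrow> b \<in> paths Q \<Longrightarrow> (i, mono_of b) \<in> signatures m"
  unfolding signatures_def by blast

lemma less_E_total: "strict_total_on (signatures m) less_E"
  using signature_ordering_E by (simp add: signature_ordering_def)

lemma sig_times_closed:
  assumes "s \<in> signatures m" "u \<in> paths Q"
  shows "snd (sig_times s u) = 0 \<or> sig_times s u \<in> signatures m"
  using assms(1)
proof (cases rule: signatures_cases)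
  case (1 i b)
  then show ?thesis
    using assms(2) mono_of_signature quiver.path_comp_in_paths by (simp add: sig_times_mono_of)
next
  case (2 i)
  then show ?thesis using assms(2) mono_of_signature by (simp add: sig_times_one)
qed

text \<open>
  Equality is an alternative also for \<open>u \<noteq> w\<close>: parallel paths annihilate the same signatures.
\<close>
lemma sig_times_mono:
  assumes s: "s \<in> signatures m" and u: "u \<in> paths Q" "w \<in> paths Q" "fst u = fst w"
      "path_end Q u = path_end Q w"
    and le: "u = w \<or> less_P u w"
  shows "sig_times s u = sig_times s w \<or>
    sig_times s u \<in> signatures m \<and> sig_times s w \<in> signatures m \<and> snd (sig_times s w) \<noteq> 0 \<and>
    less_E (sig_times s u) (sig_times s w)"
proof (cases "u = w")
  case False
  with le have less: "less_P u w" by simp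
  have ord: "less_E (i, mono_of b2) (i, mono_of b1)"
    if "i < m" "b1 \<in> paths Q" "b2 \<in> paths Q" "less_P b2 b1" for i b1 b2
    using signature_ordering_E that unfolding signature_ordering_def by blast
  have ne: "mono_of b \<noteq> (0 :: ('v, 'e) path \<Rightarrow>\<^sub>0 'k)" for b
    by (metis keys_single keys_zero insert_not_empty zero_neq_one)
  from s show ?thesis
  proof (cases rule: signatures_cases)
    case (1 i b)
    show ?thesis
    proof (cases "composable Q b w")
      case True
      then have u': "composable Q b u" using u(3) by (simp add: composable_def)
      note p = quiver.path_comp_in_paths[OF 1(2) u(1) u']
        quiver.path_comp_in_paths[OF 1(2) u(2) True]
      show ?thesis
        unfolding 1(3) sig_times_mono_of
        using True u' p ne ord[OF 1(1) p(2,1) less_P_comp_left[OF 1(2) u(1,2) u' u(3,4) less]] 1(1)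
          mono_of_signature by simp
    next
      case False
      then show ?thesis
        unfolding 1(3) sig_times_mono_of using u(3) by (simp add: composable_def)
    qed
  next
    case (2 i)
    then show ?thesis
      using ord[OF 2(1) u(2,1) less] u ne mono_of_signature by (simp add: sig_times_one)
  qed
qed simp

lemma sig_times_assoc:
  "composable Q u w \<Longrightarrow> sig_times (sig_times s u) w = sig_times s (path_comp u w)"
  by (simp add: sig_times_def gen_mult_def path_mult_assoc path_mult_single)

definition divides_F :: "nat \<times> 'a \<Rightarrow> nat \<times> 'a \<Rightarrow> bool" where
  "divides_F x y \<longleftrightarrow> fst x = fst y \<and> strictly_divides (snd x) (snd y)"

definition shift :: "('v, 'e, 'k) signature \<Rightarrow> nat \<times> 'a \<Rightarrow> nat \<times> 'a \<Rightarrow> ('v, 'e, 'k) signature" where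
  "shift s x y = sig_times s (quotient (snd x) (snd y))"

lemma mem_monomials: "x \<in> module_monomials r \<longleftrightarrow> fst x < r \<and> snd x \<in> basis"
  by (cases x) (simp add: module_monomials_def)

lemma divides_if_cofactor:
  assumes "x \<in> module_monomials r" "y \<in> module_monomials r"
    and "small_cofactor (snd x) c" "gen_mult A x c = y"
  shows "divides_F x y"
  using small_cofactor_divides[OF _ assms(3), of "snd y"] assms
  unfolding mem_monomials divides_F_def gen_mult_def by (metis fst_conv snd_conv)

text \<open>
  Among all small cofactors that take \<open>x\<close> to \<open>y\<close> the quotient path is the smallest, hence so is
  its product with any signature.
\<close>
lemma shift_least:
  assumes s: "s \<in> signatures m" and x: "x \<in> module_monomials r" and y: "y \<in> module_monomials r"
    and c: "small_cofactor (snd x) c" "gen_mult A x c = y"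
  shows "shift s x y = sig_mult s c \<or>
    shift s x y \<in> signatures m \<and> sig_mult s c \<in> signatures m \<and> snd (sig_mult s c) \<noteq> 0 \<and>
    less_E (shift s x y) (sig_mult s c)"
proof -
  have b: "snd x \<in> basis" "snd y \<in> basis" using x y by (simp_all add: mem_monomials)
  have cb: "c \<in> basis" using c(1) by (simp add: small_cofactor_def)
  have xc: "snd x \<otimes> c = snd y" using c(2) by (metis gen_mult_def snd_conv)
  have div: "strictly_divides (snd x) (snd y)" using divides_if_cofactor[OF x y c]
    by (simp add: divides_F_def)
  note q = quotient_path[OF div]
  have "fst (quotient (snd x) (snd y)) = fst (lam c) \<and>
      path_end Q (quotient (snd x) (snd y)) = path_end Q (lam c) \<and>
      (quotient (snd x) (snd y) = lam c \<or> less_P (quotient (snd x) (snd y)) (lam c))"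
    using cofactor_ge_quotient[OF b(1) cb b(2) xc q composable_quotient[OF div]
      lam_quotient[OF div]] .
  then show ?thesis
    unfolding shift_def sig_mult_eq using sig_times_mono[OF s q lam_path[OF cb]] by blast
qed

lemma shift_attained:
  assumes x: "x \<in> module_monomials r" and y: "y \<in> module_monomials r" and "divides_F x y"
  obtains c where "small_cofactor (snd x) c" "gen_mult A x c = y" "\<And>s. sig_mult s c = shift s x y"
proof
  let ?c = "psi (mono_of (quotient (snd x) (snd y)))"
  have b: "snd x \<in> basis" "snd y \<in> basis" "strictly_divides (snd x) (snd y)" "fst x = fst y"
    using assms by (simp_all add: mem_monomials divides_F_def)
  show "small_cofactor (snd x) ?c" using small_cofactor_quotient[OF b(1-3)] .
  show "gen_mult A x ?c = y" using mult_quotient[OF b(1-3)] b(4) by (simp add: gen_mult_def)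
  show "sig_mult s ?c = shift s x y" for s
    using lam_psi_quotient[OF b(1-3)] by (simp add: shift_def sig_mult_eq)
qed

lemma sig_less_shift:
  assumes "s \<in> signatures m" "x \<in> module_monomials r" "y \<in> module_monomials r"
    and "small_cofactor (snd x) c" "gen_mult A x c = y" and t: "t \<in> signatures m"
    and "sig_less (sig_mult s c) t"
  shows "sig_less (shift s x y) t"
  using shift_least[OF assms(1-5)] assms(7) strict_total_onD(2)[OF less_E_total _ _ t]
  unfolding sig_less_def by metis

end


section \<open>Leading monomials in the free module\<close>

context f5_setting
begin

lemma module_ordering_total: "strict_total_on (module_monomials r) less_F"
  using module_ordering_F by (simp add: module_ordering_def)

text \<open>
  Multiplication by \<open>c\<close> from the right is linear, so it is determined by the products of \<open>c\<close>
  with the monomials of \<open>a\<close>.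
\<close>
lemma coeff_A_mult:
  assumes a: "a \<in> carrier A" and c: "c \<in> carrier A"
  shows "coeff_A (a \<otimes> c) b = (\<Sum>u\<in>Poly_Mapping.keys (rep a).
    coeff_A a (psi (mono_of u)) * coeff_A (psi (mono_of u) \<otimes> c) b)"
proof -
  have single: "psi (Poly_Mapping.single u k) = scalar k \<otimes> psi (mono_of u)" if "u \<in> paths Q" for u k
  proof -
    have "path_mult Q (scalar_P k) (mono_of u) = Poly_Mapping.single u k"
      by (rule poly_mapping_eqI)
        (use that in \<open>simp add: lookup_scalar_P_mult lookup_single when_def\<close>)
    then show ?thesis
      using psi_simps(3)[OF scalar_P_in_P single_in_P[OF that], of k 1] by (simp add: scalar_eq)
  qed
  have psi_in: "psi (mono_of u) \<in> carrier A" if "u \<in> paths Q" for u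
    using hom_closed[OF single_in_P[OF that]] .
  have "rep (psi (\<Sum>u\<in>U. Poly_Mapping.single u (k u)) \<otimes> c) =
        (\<Sum>u\<in>U. rep (scalar (k u) \<otimes> (psi (mono_of u) \<otimes> c))) \<and>
      (\<Sum>u\<in>U. Poly_Mapping.single u (k u)) \<in> carrier P"
    if "finite U" "U \<subseteq> paths Q" for U and k :: "_ \<Rightarrow> 'k"
    using that
  proof (induction U rule: finite_induct)
    case empty
    then show ?case using c by (simp add: psi_simps)
  next
    case (insert u U)
    let ?s = "Poly_Mapping.single u (k u)" and ?t = "\<Sum>u\<in>U. Poly_Mapping.single u (k u)"
    have u: "u \<in> paths Q" and U: "U \<subseteq> paths Q" using insert.prems by simp_all
    have s: "?s \<in> carrier P" using single_in_P[OF u] .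
    have t: "?t \<in> carrier P" using insert.IH[OF U] by simp
    have "psi (?s + ?t) \<otimes> c = scalar (k u) \<otimes> (psi (mono_of u) \<otimes> c) \<oplus> psi ?t \<otimes> c"
      unfolding psi_simps(2)[OF s t] S.l_distr[OF hom_closed[OF s] hom_closed[OF t] c]
      unfolding single[OF u, of "k u"] S.m_assoc[OF scalar_closed psi_in[OF u] c] ..
    then have "rep (psi (?s + ?t) \<otimes> c) = rep (scalar (k u) \<otimes> (psi (mono_of u) \<otimes> c)) + rep
      (psi ?t \<otimes> c)"
      using rep_add S.m_closed scalar_closed psi_in[OF u] c hom_closed[OF t] by simp
    moreover have "?s + ?t \<in> carrier P" using R.a_closed[OF s t] by simp
    ultimately show ?case using insert.IH[OF U] insert.hyps by simp
  qed
  from this[of "Poly_Mapping.keys (rep a)" "Poly_Mapping.lookup (rep a)"] rep_in_P[OF a]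
  have "rep (a \<otimes> c) = (\<Sum>u\<in>Poly_Mapping.keys (rep a).
      rep (scalar (Poly_Mapping.lookup (rep a) u) \<otimes> (psi (mono_of u) \<otimes> c)))"
    by (simp add: poly_mapping_sum_single[symmetric] psi_rep[OF a])
  then show ?thesis
    unfolding coeff_A_eq lookup_sum
  proof (simp only: lookup_sum, intro sum.cong refl)
    fix u assume "u \<in> Poly_Mapping.keys (rep a)"
    then have u: "u \<in> std_mon" using keys_rep[OF a] subsetD by metis
    then have uc: "psi (mono_of u) \<otimes> c \<in> carrier A" using S.m_closed[OF psi_in c] std_mon_paths
      by simp
    show "Poly_Mapping.lookup (rep (scalar (Poly_Mapping.lookup (rep a) u) \<otimes>
      (psi (mono_of u) \<otimes> c))) (lam b) =
        Poly_Mapping.lookup (rep a) (lam (psi (mono_of u))) *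
        Poly_Mapping.lookup (rep (psi (mono_of u) \<otimes> c)) (lam b)"
      unfolding lookup_rep_scale[OF uc] lam_psi[OF u] ..
  qed
qed

lemma free_module_closed: "f \<in> free_module A r \<Longrightarrow> f i \<in> carrier A"
  unfolding free_module_def by (cases "i < r") simp_all

lemma F_diff_closed: "f \<in> free_module A r \<Longrightarrow> g \<in> free_module A r \<Longrightarrow> F_diff f g \<in> free_module A r"
  unfolding free_module_def F_diff_def by (simp add: S.minus_eq)

lemma F_scale_closed: "f \<in> free_module A r \<Longrightarrow> F_scale k f \<in> free_module A r"
  using scalar_closed unfolding free_module_def F_scale_def by simp

lemma F_mult_closed: "f \<in> free_module A r \<Longrightarrow> c \<in> carrier A \<Longrightarrow> F_mult f c \<in> free_module A r"
  unfolding free_module_def F_mult_def by simp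

lemma coeff_F_diff:
  "f \<in> free_module A r \<Longrightarrow> g \<in> free_module A r \<Longrightarrow>
    coeff_F (F_diff f g) x = coeff_F f x - coeff_F g x"
  by (simp add: coeff_F_def F_diff_def coeff_A_diff free_module_closed)

lemma coeff_F_scale: "f \<in> free_module A r \<Longrightarrow> coeff_F (F_scale k f) x = k * coeff_F f x"
  by (simp add: coeff_F_def F_scale_def coeff_A_scale free_module_closed)

lemma
  assumes f: "f \<in> free_module A r" "f \<noteq> F_zero"
  shows lm_F_in: "lm_F f \<in> module_monomials r" and lc_F_nonzero: "lc_F f \<noteq> 0"
    and less_lm_F: "\<And>x. x \<in> module_monomials r \<Longrightarrow> coeff_F f x \<noteq> 0 \<Longrightarrow> x \<noteq> lm_F f \<Longrightarrow> less_F x (lm_F f)"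
proof -
  let ?S = "{x \<in> module_monomials r. coeff_F f x \<noteq> 0}"
  have "?S \<subseteq> (SIGMA i:{..<r}. {b \<in> basis. coeff_A (f i) b \<noteq> 0})"
    by (clarsimp simp: module_monomials_def coeff_F_def)
  then have fin: "finite ?S" by (rule finite_subset) (simp add: finite_support)
  have ne: "?S \<noteq> {}"
  proof
    assume empty: "?S = {}"
    have "f i = \<zero>" for i
    proof (cases "i < r")
      case True
      have "coeff_A (f i) b = 0" if "b \<in> basis" for b
        using empty True that mem_monomials[of "(i, b)"] by (simp add: coeff_F_def)
      then show ?thesis using eq_zero_if_coeffs_zero free_module_closed[OF f(1)] by metis
    qed (use f(1) in \<open>simp add: free_module_def\<close>)
    then show False using f(2) by (simp add: F_zero_def fun_eq_iff)
  qed
  have sub: "?S \<subseteq> module_monomials r" by simp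
  have "lm_F f \<in> ?S"
    unfolding lm_F_def by (rule greatest_in[OF module_ordering_total fin ne sub])
  then show "lm_F f \<in> module_monomials r" "lc_F f \<noteq> 0" by (simp_all add: lc_F_def)
  show "less_F x (lm_F f)" if "x \<in> module_monomials r" "coeff_F f x \<noteq> 0" "x \<noteq> lm_F f" for x
    using less_greatest[OF module_ordering_total fin ne sub, of x] that by (simp add: lm_F_def)
qed

lemma lm_F_eqI:
  assumes "x \<in> module_monomials r" "coeff_F f x \<noteq> 0"
    and "\<And>y. y \<in> module_monomials r \<Longrightarrow> coeff_F f y \<noteq> 0 \<Longrightarrow> y \<noteq> x \<Longrightarrow> less_F y x"
  shows "lm_F f = x"
  unfolding lm_F_def
  by (rule greatest_eqI[OF module_ordering_total]) (use assms in simp_all)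

text \<open>
  Compatibility of the module ordering with small cofactors keeps the products of all smaller
  monomials of \<open>g\<close> below \<open>x\<close>, so nothing can cancel the leading term.
\<close>
lemma
  assumes g: "g \<in> free_module A r" "g \<noteq> F_zero"
    and c: "small_cofactor (snd (lm_F g)) c" "gen_mult A (lm_F g) c = x" "x \<in> module_monomials r"
  shows coeff_F_mult_lm: "coeff_F (F_mult g c) x = lc_F g"
    and less_F_mult_lm: "\<And>y. y \<in> module_monomials r \<Longrightarrow> coeff_F (F_mult g c) y \<noteq> 0 \<Longrightarrow> y \<noteq> x \<Longrightarrow>
      less_F y x"
proof -
  let ?l = "lm_F g"
  have l: "?l \<in> module_monomials r" using lm_F_in[OF g] .
  have cb: "c \<in> basis" "c \<in> carrier A" using c(1) basis_closed by (simp_all add: small_cofactor_def)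
  have x: "fst x = fst ?l" "snd x = snd ?l \<otimes> c" unfolding c(2)[symmetric]
    by (simp_all add: gen_mult_def)
  (* a monomial of g other than the leading one stays below x after multiplication by c *)
  have smaller: "less_F y x"
    if y: "y \<in> module_monomials r" and b: "b \<in> basis" "coeff_A (g (fst y)) b \<noteq> 0" "(fst y, b) \<noteq> ?l"
      and yb: "coeff_A (b \<otimes> c) (snd y) \<noteq> 0" for y b
  proof -
    have i: "fst y < r" "snd y \<in> basis" using y by (simp_all add: mem_monomials)
    have "less_F (fst y, b) ?l"
      using less_lm_F[OF g, of "(fst y, b)"] b i by (simp add: mem_monomials coeff_F_def)
    moreover have bc: "b \<otimes> c \<noteq> \<zero>" using yb coeff_A_zero by metis
    ultimately have lt: "less_F (fst y, lm_A (b \<otimes> c)) x"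
      using module_ordering_F i(1) b(1) l c cb(1) lm_A_basis[of "snd x"] x
      unfolding module_ordering_def mem_monomials by (metis prod.collapse)
    have bcA: "b \<otimes> c \<in> carrier A" using b(1) basis_closed cb(2) by simp
    show ?thesis
    proof (cases "snd y = lm_A (b \<otimes> c)")
      case True
      with lt show ?thesis by (metis prod.collapse)
    next
      case False
      then have "less_A (snd y) (lm_A (b \<otimes> c))" using less_lm_A[OF bcA bc i(2) yb] by simp
      then have "less_F (fst y, snd y) (fst y, lm_A (b \<otimes> c))"
        using module_ordering_F i lm_A_in_basis[OF bcA bc] unfolding module_ordering_def by blast
      moreover have "(fst y, lm_A (b \<otimes> c)) \<in> module_monomials r"
        using i(1) lm_A_in_basis[OF bcA bc] by (simp add: mem_monomials)
      ultimately show ?thesis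
        using strict_total_onD(2)[OF module_ordering_total y _ c(3) _ lt] by (metis prod.collapse)
    qed
  qed
  have basis_psi: "psi (mono_of u) \<in> basis" if "u \<in> Poly_Mapping.keys (rep (g i))" for u i
    using psi_in_basis keys_rep[OF free_module_closed[OF g(1)]] that subsetD by metis
  have coeff_ne: "coeff_A (g i) (psi (mono_of u)) \<noteq> 0" if "u \<in> Poly_Mapping.keys (rep (g i))"
    for u i
    using lam_psi keys_rep[OF free_module_closed[OF g(1)]] that subsetD
    unfolding coeff_A_eq by (metis in_keys_iff)
  have expand: "coeff_F (F_mult g c) y = (\<Sum>u\<in>Poly_Mapping.keys (rep (g (fst y))).
      coeff_A (g (fst y)) (psi (mono_of u)) * coeff_A (psi (mono_of u) \<otimes> c) (snd y))" for y
    unfolding coeff_F_def F_mult_def by (rule coeff_A_mult[OF free_module_closed[OF g(1)] cb(2)])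
  show "less_F y x" if y: "y \<in> module_monomials r" "coeff_F (F_mult g c) y \<noteq> 0" "y \<noteq> x" for y
  proof -
    obtain u where u: "u \<in> Poly_Mapping.keys (rep (g (fst y)))"
        "coeff_A (psi (mono_of u) \<otimes> c) (snd y) \<noteq> 0"
      using y(2) unfolding expand by (metis (no_types, lifting) mult_zero_right sum.neutral)
    have "(fst y, psi (mono_of u)) \<noteq> ?l"
    proof
      assume eq: "(fst y, psi (mono_of u)) = ?l"
      then have "psi (mono_of u) \<otimes> c = snd x" "fst y = fst x" using x by (metis fst_conv snd_conv)+
      then show False
        using u(2) y(1,3) c(3) coeff_A_basis[of "snd x" "snd y"]
        unfolding mem_monomials by (metis prod.expand)
    qed
    then show ?thesis using smaller[OF y(1) basis_psi[OF u(1)] coeff_ne[OF u(1)] _ u(2)] by simp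
  qed
  have sb: "snd ?l \<in> basis" "snd x \<in> basis" using l c(3) by (simp_all add: mem_monomials)
  let ?K = "Poly_Mapping.keys (rep (g (fst x)))"
  have "coeff_F (F_mult g c) x = (\<Sum>u\<in>?K. if u = lam (snd ?l) then lc_F g else 0)"
    unfolding expand
  proof (rule sum.cong[OF refl])
    fix u assume u: "u \<in> ?K"
    have std: "u \<in> std_mon" using keys_rep[OF free_module_closed[OF g(1)]] u subsetD by metis
    show "coeff_A (g (fst x)) (psi (mono_of u)) * coeff_A (psi (mono_of u) \<otimes> c) (snd x) =
        (if u = lam (snd ?l) then lc_F g else 0)"
    proof (cases "u = lam (snd ?l)")
      case True
      then show ?thesis
        using psi_lam[OF sb(1)] x coeff_A_basis[OF sb(2,2)] by (simp add: lc_F_def coeff_F_def)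
    next
      case False
      then have ne: "(fst x, psi (mono_of u)) \<noteq> ?l" using lam_psi[OF std] by (metis snd_conv)
      have "\<not> less_F x x" using strict_total_onD(1)[OF module_ordering_total c(3)] .
      then have "coeff_A (psi (mono_of u) \<otimes> c) (snd x) = 0"
        using smaller[OF c(3) basis_psi[OF u] coeff_ne[OF u] ne] by metis
      with False show ?thesis by simp
    qed
  qed
  also have "\<dots> = lc_F g"
  proof -
    have "lam (snd ?l) \<in> ?K"
      using lc_F_nonzero[OF g] x(1) by (simp add: in_keys_iff lc_F_def coeff_F_def coeff_A_eq)
    then show ?thesis by (simp add: sum.delta)
  qed
  finally show "coeff_F (F_mult g c) x = lc_F g" .
qed

lemma lm_F_mult:
  assumes g: "g \<in> free_module A r" "g \<noteq> F_zero"
    and c: "small_cofactor (snd (lm_F g)) c" "gen_mult A (lm_F g) c = x" "x \<in> module_monomials r"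
  shows "lm_F (F_mult g c) = x"
  using lm_F_eqI[OF c(3), of "F_mult g c"] coeff_F_mult_lm[OF assms] less_F_mult_lm[OF assms]
    lc_F_nonzero[OF g]
  by simp

definition nonzero_elements :: "('a, 'v, 'e, 'k) signed set \<Rightarrow> bool" where
  "nonzero_elements G \<longleftrightarrow> (\<forall>g\<in>G. fst g \<in> free_module A r \<and> fst g \<noteq> F_zero)"

lemma reducer_cofactor: "reducer G s f g c \<Longrightarrow> c \<in> carrier A"
  using basis_closed by (simp add: reducer_def small_cofactor_of_lm_def small_cofactor_def)

lemma nf_step_closed:
  assumes "nonzero_elements G" "f \<in> free_module A r" "nf_step G s f f'"
  shows "f' \<in> free_module A r"
proof -
  obtain g c where red: "reducer G s f g c"
    and f': "f' = F_diff f (F_scale (lc_F f / lc_F (fst g)) (F_mult (fst g) c))"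
    using assms(3) unfolding nf_step_def by metis
  have "fst g \<in> free_module A r" using red assms(1) by (simp add: reducer_def nonzero_elements_def)
  then show ?thesis
    unfolding f' using F_diff_closed[OF assms(2) F_scale_closed[OF F_mult_closed]]
      reducer_cofactor[OF red] by simp
qed

text \<open>
  The multiple of the reducer is scaled so that the coefficients at the common leading monomial
  cancel, and all other monomials of both are smaller.
\<close>
lemma nf_step_less:
  assumes "nonzero_elements G" "f \<in> free_module A r" "nf_step G s f f'" "f' \<noteq> F_zero"
  shows "less_F (lm_F f') (lm_F f)"
proof -
  obtain g c where red: "reducer G s f g c" and f: "f \<noteq> F_zero"
    and f': "f' = F_diff f (F_scale (lc_F f / lc_F (fst g)) (F_mult (fst g) c))"
    using assms(3) unfolding nf_step_def by metis
  have g: "fst g \<in> free_module A r" "fst g \<noteq> F_zero" using red assms(1)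
    by (simp_all add: reducer_def nonzero_elements_def)
  have c: "small_cofactor (snd (lm_F (fst g))) c" "gen_mult A (lm_F (fst g)) c = lm_F f"
    using red by (simp_all add: reducer_def small_cofactor_of_lm_def)
  have lf: "lm_F f \<in> module_monomials r" using lm_F_in[OF assms(2) f] .
  have gc: "F_mult (fst g) c \<in> free_module A r"
    using F_mult_closed[OF g(1) reducer_cofactor[OF red]] .
  have co: "coeff_F f' x = coeff_F f x - lc_F f / lc_F (fst g) * coeff_F (F_mult (fst g) c) x" for x
    unfolding f' coeff_F_diff[OF assms(2) F_scale_closed[OF gc]] coeff_F_scale[OF gc] ..
  have f'F: "f' \<in> free_module A r" using nf_step_closed[OF assms(1-3)] .
  have l': "lm_F f' \<in> module_monomials r" "coeff_F f' (lm_F f') \<noteq> 0"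
    using lm_F_in[OF f'F assms(4)] lc_F_nonzero[OF f'F assms(4)] by (simp_all add: lc_F_def)
  have "coeff_F f' (lm_F f) = 0"
    unfolding co coeff_F_mult_lm[OF g c lf] using lc_F_nonzero[OF g] by (simp add: lc_F_def)
  then have ne: "lm_F f' \<noteq> lm_F f" using l'(2) by metis
  have "coeff_F f (lm_F f') \<noteq> 0 \<or> coeff_F (F_mult (fst g) c) (lm_F f') \<noteq> 0"
    using l'(2) unfolding co by (metis diff_zero mult_zero_right)
  then show ?thesis
    using less_lm_F[OF assms(2) f l'(1)] less_F_mult_lm[OF g c lf l'(1)] ne by metis
qed

end


section \<open>Normal forms and interreduction\<close>

locale f5_basic_setting = f5_setting Q A psi less_P r less_F m less_E gens
  for Q :: "('v, 'e) pre_digraph" and A :: "('a, 'b) ring_scheme" (structure)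
    and psi :: "(('v, 'e) path \<Rightarrow>\<^sub>0 'k::field) \<Rightarrow> 'a"
    and less_P r less_F m less_E gens +
  assumes basic: basic_algebra
begin

text \<open>
  A finite spanning family has finitely many monomials in all its coordinates together, and
  linear combinations involve no others. This bounds the basis, since each of its elements is
  its own only coordinate.
\<close>
lemma dimension_keys:
  assumes "S.dimension n (range scalar) E"
  shows "E \<subseteq> carrier A \<and> (\<exists>U. finite U \<and> (\<forall>a\<in>E. Poly_Mapping.keys (rep a) \<subseteq> U))"
  using assms
proof (induction n "range scalar" E rule: S.dimension.induct)
  case (Suc_dim v E n)
  then obtain U where U: "finite U" "\<And>a. a \<in> E \<Longrightarrow> Poly_Mapping.keys (rep a) \<subseteq> U"
    and E: "E \<subseteq> carrier A"
    by metis
  have "a \<in> carrier A \<and> Poly_Mapping.keys (rep a) \<subseteq> Poly_Mapping.keys (rep v) \<union> U"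
    if line: "a \<in> S.line_extension (range scalar) v E" for a
  proof -
    obtain k w where kw: "w \<in> E" "a = scalar k \<otimes> v \<oplus> w"
      using line unfolding S.line_extension_mem_iff by blast
    have w: "w \<in> carrier A" using kw(1) E by blast
    have kv: "scalar k \<otimes> v \<in> carrier A" using S.m_closed[OF scalar_closed Suc_dim.hyps(1)] .
    have kvk: "Poly_Mapping.keys (rep (scalar k \<otimes> v)) \<subseteq> Poly_Mapping.keys (rep v)"
      unfolding subset_iff in_keys_iff lookup_rep_scale[OF Suc_dim.hyps(1)]
        by (simp add: subset_iff)
    have "Poly_Mapping.keys (rep a) \<subseteq> Poly_Mapping.keys (rep v) \<union> U"
      unfolding kw(2) rep_add[OF kv w]
      by (rule order.trans[OF keys_add Un_mono[OF kvk U(2)[OF kw(1)]]])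
    moreover have "a \<in> carrier A" unfolding kw(2) using S.a_closed[OF kv w] .
    ultimately show ?thesis by simp
  qed
  moreover have "finite (Poly_Mapping.keys (rep v) \<union> U)" using U(1) by simp
  ultimately show ?case by (meson subsetI)
qed auto

lemma finite_std_mon: "finite std_mon"
proof -
  obtain n where "S.dimension n (range scalar) (carrier A)"
    using basic unfolding basic_algebra_def S.finite_dimension_def by blast
  then obtain U where U: "finite U" "\<And>a. a \<in> carrier A \<Longrightarrow> Poly_Mapping.keys (rep a) \<subseteq> U"
    using dimension_keys by metis
  have "std_mon \<subseteq> U"
  proof
    fix u assume u: "u \<in> std_mon"
    then show "u \<in> U"
      using U(2)[OF basis_closed[OF psi_in_basis[OF u]]] rep_psi_mono[OF u] by simp
  qed
  with U(1) show ?thesis using finite_subset by blast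
qed

lemma finite_monomials: "finite (module_monomials r)"
  using finite_std_mon unfolding module_monomials_def basis_def by simp

text \<open>
  A finite set that contains the signatures of all elements that ever enter \<open>G\<close>: the
  S-polynomials of normal critical pairs have standard signatures.
\<close>
definition sigs :: "('v, 'e, 'k) signature set" where
  "sigs = (\<lambda>(i, u). (i, mono_of u)) ` ({..<m} \<times> std_mon) \<union> (\<lambda>i. (i, \<one>\<^bsub>P\<^esub>)) ` {..<m}"

lemma finite_sigs: "finite sigs"
  using finite_std_mon by (simp add: sigs_def)

lemma sigs_signatures: "sigs \<subseteq> signatures m"
proof
  fix s assume "s \<in> sigs"
  then consider i u where "i < m" "u \<in> std_mon" "s = (i, mono_of u)" | i where "i < m"
    "s = (i, \<one>\<^bsub>P\<^esub>)"
    unfolding sigs_def by auto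
  then show "s \<in> signatures m"
    using mono_of_signature std_mon_paths by cases (simp, simp add: signatures_def)
qed

abbreviation rank_F :: "nat \<times> 'a \<Rightarrow> nat" where
  "rank_F \<equiv> rank_in less_F (module_monomials r)"

lemma rank_F_less:
  "x \<in> module_monomials r \<Longrightarrow> y \<in> module_monomials r \<Longrightarrow> less_F x y \<Longrightarrow> rank_F x < rank_F y"
  using rank_in_less[OF module_ordering_total finite_monomials] .

lemma nf_halts:
  assumes "nonzero_elements G" "fst f \<in> free_module A r"
  shows "nf_halts G f"
  unfolding nf_halts_def
  (* the zero element has no leading monomial and is ranked below all others *)
proof (rule halts_from_measure[where Inv = "\<lambda>h. h \<in> free_module A r"
      and \<mu> = "\<lambda>h. if h = F_zero then 0 else Suc (rank_F (lm_F h))"])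
  fix h h' assume h: "h \<in> free_module A r" and step: "nf_step G (snd f) h h'"
  have h0: "h \<noteq> F_zero" using step by (simp add: nf_step_def)
  have h': "h' \<in> free_module A r" using nf_step_closed[OF assms(1) h step] .
  have "rank_F (lm_F h') < rank_F (lm_F h)" if "h' \<noteq> F_zero"
    using rank_F_less[OF lm_F_in[OF h' that] lm_F_in[OF h h0]
      nf_step_less[OF assms(1) h step that]] .
  with h' h0 show "h' \<in> free_module A r \<and>
      ((if h' = F_zero then 0 else Suc (rank_F (lm_F h'))),
       (if h = F_zero then 0 else Suc (rank_F (lm_F h)))) \<in> less_than"
    by simp
qed (use assms in simp_all)

lemma nf_steps:
  assumes G: "nonzero_elements G" and f: "f \<in> free_module A r" and steps: "(nf_step G s)\<^sup>*\<^sup>* f h"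
  shows "h \<in> free_module A r \<and> (h = f \<or> h = F_zero \<or> less_F (lm_F h) (lm_F f))"
  using steps
proof (induction rule: rtranclp_induct)
  case (step h h')
  have h: "h \<in> free_module A r" and h0: "h \<noteq> F_zero" using step.IH step.hyps(2)
    by (simp_all add: nf_step_def)
  have h': "h' \<in> free_module A r" using nf_step_closed[OF G h step.hyps(2)] .
  have "less_F (lm_F h') (lm_F f)" if nz: "h' \<noteq> F_zero"
  proof -
    have lt: "less_F (lm_F h') (lm_F h)" using nf_step_less[OF G h step.hyps(2) nz] .
    show ?thesis
    proof (cases "h = f")
      case True
      with lt show ?thesis by simp
    next
      case False
      then have "less_F (lm_F h) (lm_F f)" using step.IH h0 by simp
      moreover have "f \<noteq> F_zero"
        using steps False step.hyps(1) nf_step_def by (metis converse_rtranclpE)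
      ultimately show ?thesis
        using strict_total_onD(2)[OF module_ordering_total lm_F_in[OF h' nz] lm_F_in[OF h h0]
          lm_F_in[OF f]] lt
        by simp
    qed
  qed
  with h' show ?case by blast
qed (use f in simp)

lemma nf_irreducible:
  assumes "nf G f f'" "fst f' \<noteq> F_zero"
  shows "\<not> reducer G (snd f) (fst f') g c"
  using assms unfolding nf_def nf_step_def by blast

definition admissible :: "('a, 'v, 'e, 'k) signed set \<Rightarrow> bool" where
  "admissible G \<longleftrightarrow> finite G \<and> nonzero_elements G \<and> snd ` G \<subseteq> sigs"

lemma admissible_subset: "admissible G \<Longrightarrow> G' \<subseteq> G \<Longrightarrow> admissible G'"
  unfolding admissible_def nonzero_elements_def
    by (meson finite_subset image_mono order_trans subsetD)

lemma admissible_insert: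
  "admissible (insert g G) \<longleftrightarrow> admissible G \<and> fst g \<in> free_module A r \<and> fst g \<noteq> F_zero \<and> snd g \<in> sigs"
  unfolding admissible_def nonzero_elements_def by auto

lemma admissibleD:
  assumes "admissible G" "g \<in> G"
  shows "fst g \<in> free_module A r" "fst g \<noteq> F_zero" "snd g \<in> sigs"
    "lm_F (fst g) \<in> module_monomials r"
  using assms lm_F_in unfolding admissible_def nonzero_elements_def by auto

text \<open>
  All three kinds of interreduction steps take out an element \<open>g\<close> whose head is displaced by
  that of some \<open>h\<close>, and possibly put back an irreducible element of the same signature with a
  smaller leading monomial.
\<close>
lemma interred_stepE:
  assumes G: "admissible G" and step: "interred_step (G, L) S"
  obtains g h c where "g \<in> G" "h \<in> G" "h \<noteq> g"
    "small_cofactor (snd (lm_F (fst h))) c" "gen_mult A (lm_F (fst h)) c = lm_F (fst g)"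
    "sig_less (sig_mult (snd h) c) (snd g) \<or> sig_mult (snd h) c = snd g"
    "fst S = G - {g} \<or> (\<exists>g'. fst S = insert g' (G - {g}) \<and> snd g' = snd g \<and>
       fst g' \<in> free_module A r \<and> fst g' \<noteq> F_zero \<and> less_F (lm_F (fst g')) (lm_F (fst g)) \<and>
       (\<forall>h c. \<not> reducer (G - {g}) (snd g) (fst g') h c))"
  using step
proof (cases rule: interred_step.cases)
  case (same_signature g h c)
  then show ?thesis using that[of g h c] by (simp add: small_cofactor_of_lm_def)
next
  case (reduce g g')
  have nf: "snd g' = snd g" "(nf_step (G - {g}) (snd g))\<^sup>*\<^sup>* (fst g) (fst g')"
    using reduce by (simp_all add: nf_def)
  then have ne: "fst g' \<noteq> fst g" using reduce(4) by (metis prod.expand)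
  obtain f where "nf_step (G - {g}) (snd g) (fst g) f"
    using nf(2) ne by (metis converse_rtranclpE)
  then obtain h c where hc: "reducer (G - {g}) (snd g) (fst g) h c" unfolding nf_step_def by blast
  have g: "fst g \<in> free_module A r" using admissibleD[OF G reduce(2)] by simp
  have Gg: "nonzero_elements (G - {g})" using admissible_subset[OF G, of "G - {g}"]
    by (auto simp: admissible_def)
  have g': "fst g' \<in> free_module A r" "less_F (lm_F (fst g')) (lm_F (fst g))"
    using nf_steps[OF Gg g nf(2)] ne reduce(5) by simp_all
  have "fst S = insert g' (G - {g})" using reduce(1) by simp
  moreover have "\<not> reducer (G - {g}) (snd g) (fst g') h c" for h c
    using nf_irreducible[OF reduce(3,5)] .
  ultimately show ?thesis
    using that[of g h c] hc[unfolded reducer_def small_cofactor_of_lm_def] reduce(2,5) nf(1) g'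
      by blast
next
  case (zero_reduction g g')
  have nf: "snd g' = snd g" "(nf_step (G - {g}) (snd g))\<^sup>*\<^sup>* (fst g) (fst g')"
    using zero_reduction by (simp_all add: nf_def)
  then have ne: "fst g' \<noteq> fst g" using zero_reduction(4) by (metis prod.expand)
  obtain f where "nf_step (G - {g}) (snd g) (fst g) f"
    using nf(2) ne by (metis converse_rtranclpE)
  then obtain h c where hc: "reducer (G - {g}) (snd g) (fst g) h c" unfolding nf_step_def by blast
  then show ?thesis
    using that[of g h c] zero_reduction unfolding reducer_def small_cofactor_of_lm_def by auto
qed

definition weight :: "(('v, 'e, 'k) signature \<Rightarrow> bool) \<Rightarrow> ('a, 'v, 'e, 'k) signed set \<Rightarrow> nat" where
  "weight R G = (\<Sum>g\<in>{g \<in> G. R (snd g)}. Suc (rank_F (lm_F (fst g))))"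

lemma weight_remove:
  assumes "finite G" "g \<in> G" "R (snd g)"
  shows "weight R G = Suc (rank_F (lm_F (fst g))) + weight R (G - {g})"
proof -
  have "{h \<in> G - {g}. R (snd h)} = {h \<in> G. R (snd h)} - {g}" by blast
  then show ?thesis
    unfolding weight_def using sum.remove[of "{h \<in> G. R (snd h)}" g "\<lambda>g. Suc
      (rank_F (lm_F (fst g)))"] assms
    by simp
qed

text \<open>
  Only an inequality, as the element may belong to \<open>G\<close> already.
\<close>
lemma weight_insert_le:
  assumes "finite G"
  shows "weight R (insert g G) \<le> Suc (rank_F (lm_F (fst g))) + weight R G"
proof (cases "R (snd g) \<and> g \<notin> G")
  case True
  then have "{h \<in> insert g G. R (snd h)} = insert g {h \<in> G. R (snd h)}" by auto
  with True assms show ?thesis unfolding weight_def by simp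
next
  case False
  then have "{h \<in> insert g G. R (snd h)} = {h \<in> G. R (snd h)}" by auto
  then show ?thesis unfolding weight_def by simp
qed

lemma weight_irrelevant:
  assumes "\<not> R (snd g)"
  shows "weight R (insert g G) = weight R G" "weight R (G - {g}) = weight R G"
proof -
  have "{h \<in> insert g G. R (snd h)} = {h \<in> G. R (snd h)}"
    "{h \<in> G - {g}. R (snd h)} = {h \<in> G. R (snd h)}"
    using assms by auto
  then show "weight R (insert g G) = weight R G" "weight R (G - {g}) = weight R G"
    unfolding weight_def by simp_all
qed

lemma weight_step:
  assumes G: "admissible G" "g \<in> G" "R (snd g)"
    and G': "G' = G - {g} \<or> (\<exists>g'. G' = insert g' (G - {g}) \<and>
      fst g' \<in> free_module A r \<and> fst g' \<noteq> F_zero \<and> less_F (lm_F (fst g')) (lm_F (fst g)))"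
  shows "weight R G' < weight R G"
proof -
  have fin: "finite G" using G(1) by (simp add: admissible_def)
  note w = weight_remove[of G g R, OF fin G(2,3)]
  from G' show ?thesis
  proof
    assume "\<exists>g'. G' = insert g' (G - {g}) \<and>
      fst g' \<in> free_module A r \<and> fst g' \<noteq> F_zero \<and> less_F (lm_F (fst g')) (lm_F (fst g))"
    then obtain g' where g': "G' = insert g' (G - {g})" "fst g' \<in> free_module A r" "fst g' \<noteq> F_zero"
      "less_F (lm_F (fst g')) (lm_F (fst g))" by blast
    have "rank_F (lm_F (fst g')) < rank_F (lm_F (fst g))"
      using rank_F_less[OF lm_F_in[OF g'(2,3)] admissibleD(4)[OF G(1,2)] g'(4)] .
    then show ?thesis using w weight_insert_le[of "G - {g}" R g'] fin g'(1) by simp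
  qed (use w in simp)
qed

lemma interred_step_admissible:
  assumes "admissible G" "interred_step (G, L) S"
  shows "admissible (fst S) \<and> weight (\<lambda>_. True) (fst S) < weight (\<lambda>_. True) G"
  using assms
proof (rule interred_stepE)
  fix g h c
  assume g: "g \<in> G" and S: "fst S = G - {g} \<or> (\<exists>g'. fst S = insert g' (G - {g}) \<and> snd g' = snd g \<and>
       fst g' \<in> free_module A r \<and> fst g' \<noteq> F_zero \<and> less_F (lm_F (fst g')) (lm_F (fst g)) \<and>
       (\<forall>h c. \<not> reducer (G - {g}) (snd g) (fst g') h c))"
  have "admissible (G - {g})" using admissible_subset[OF assms(1)] by blast
  with S admissibleD(3)[OF assms(1) g] have "admissible (fst S)" by (metis admissible_insert)
  moreover have "weight (\<lambda>_. True) (fst S) < weight (\<lambda>_. True) G"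
    using S by (intro weight_step[OF assms(1) g]) blast+
  ultimately show ?thesis by blast
qed

lemma interred_halts:
  assumes "admissible G"
  shows "interred_halts (G, L)"
  unfolding interred_halts_def
proof (intro conjI allI impI ballI)
  show "halts_from interred_step (G, L)"
    by (rule halts_from_measure[where R = less_than and Inv = "\<lambda>S. admissible (fst S)"
          and \<mu> = "\<lambda>S. weight (\<lambda>_. True) (fst S)"])
      (use assms interred_step_admissible in \<open>simp_all, metis prod.collapse\<close>)
  fix G' L' g assume "interred_step\<^sup>*\<^sup>* (G, L) (G', L')" and g: "g \<in> G'"
  then have "admissible (fst (G', L'))"
    by (induction rule: rtranclp_induct) (use assms interred_step_admissible in \<open>simp, metis
      prod.collapse\<close>)
  then have G': "admissible G'" "admissible (G' - {g})" using admissible_subset by auto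
  then show "nf_halts (G' - {g}) g" using nf_halts admissibleD(1)[OF G'(1) g]
    by (simp add: admissible_def)
qed

end


section \<open>Heads of signed elements\<close>

context f5_basic_setting
begin

definition path_length :: "nat \<times> 'a \<Rightarrow> nat" where
  "path_length x = length (snd (lam (snd x)))"

definition sig_zero :: "('v, 'e, 'k) signature \<Rightarrow> bool" where
  "sig_zero s \<longleftrightarrow> snd s = 0"

text \<open>
  For a quiver with a single vertex the generators are monomials, and no signature satisfies
  this.
\<close>
definition generator_sig :: "('v, 'e, 'k) signature \<Rightarrow> bool" where
  "generator_sig s \<longleftrightarrow> \<not> (\<exists>p\<in>paths Q. snd s = mono_of p)"

lemma quotient_eqI:
  "composable Q (lam b) d \<Longrightarrow> lam t = path_comp (lam b) d \<Longrightarrow> quotient b t = d"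
  by (cases d) (simp add: quotient_def composable_def path_comp_def)

lemma divides_F_refl: "x \<in> module_monomials r \<Longrightarrow> divides_F x x"
  and quotient_refl: "quotient b b = (path_end Q (lam b), [])"
proof -
  show "quotient b b = (path_end Q (lam b), [])"
    by (rule quotient_eqI) (simp_all add: composable_def path_comp_def)
  assume x: "x \<in> module_monomials r"
  then have "lam (snd x) \<in> paths Q" using lam_path by (simp add: mem_monomials)
  then have "(path_end Q (lam (snd x)), []) \<in> paths Q"
    using quiver.path_ends_in_verts by (intro trivial_path) simp
  then show "divides_F x x"
    using quiver.path_comp_trivial_right[OF \<open>lam (snd x) \<in> paths Q\<close>]
    unfolding divides_F_def strictly_divides_def by metis
qed

lemma
  assumes "divides_F x y" "divides_F y z"
  shows divides_F_trans: "divides_F x z"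
    and quotient_trans: "quotient (snd x) (snd z) = path_comp (quotient (snd x) (snd y))
      (quotient (snd y) (snd z))"
    and composable_quotients: "composable Q (quotient (snd x) (snd y)) (quotient (snd y) (snd z))"
proof -
  have xy: "strictly_divides (snd x) (snd y)" and yz: "strictly_divides (snd y) (snd z)"
    and i: "fst x = fst z" using assms by (simp_all add: divides_F_def)
  let ?p = "quotient (snd x) (snd y)" and ?q = "quotient (snd y) (snd z)"
  note p = quotient_path[OF xy] composable_quotient[OF xy] lam_quotient[OF xy]
  note q = quotient_path[OF yz] composable_quotient[OF yz] lam_quotient[OF yz]
  show c: "composable Q ?p ?q" using q(2) path_end_comp[OF p(2)] unfolding p(3)
    by (simp add: composable_def)
  have l: "lam (snd z) = path_comp (lam (snd x)) (path_comp ?p ?q)"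
    unfolding q(3) by (subst p(3)) (simp add: path_comp_def)
  have c': "composable Q (lam (snd x)) (path_comp ?p ?q)"
    using p(2) by (simp add: composable_def path_comp_def)
  show "quotient (snd x) (snd z) = path_comp ?p ?q" by (rule quotient_eqI[OF c' l])
  show "divides_F x z"
    unfolding divides_F_def strictly_divides_def
    using i l c' quiver.path_comp_in_paths[OF p(1) q(1) c] by blast
qed

lemma divides_F_length:
  assumes "x \<in> module_monomials r" "y \<in> module_monomials r" "divides_F x y" "x \<noteq> y"
  shows "path_length x < path_length y"
proof -
  have d: "strictly_divides (snd x) (snd y)" and i: "fst x = fst y" using assms(3)
    by (simp_all add: divides_F_def)
  have "snd x \<noteq> snd y" using assms(4) i by (metis prod.expand)
  then have "lam (snd x) \<noteq> lam (snd y)"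
    using inj_lam assms(1,2) by (simp add: mem_monomials inj_on_def) metis
  then have "snd (quotient (snd x) (snd y)) \<noteq> []"
    using lam_quotient[OF d] by (metis append_Nil2 path_comp_def prod.collapse)
  then show ?thesis
    unfolding path_length_def using lam_quotient[OF d] by (simp add: path_comp_def)
qed

lemma shift_closed:
  "s \<in> sigs \<Longrightarrow> divides_F x y \<Longrightarrow> sig_zero (shift s x y) \<or> shift s x y \<in> signatures m"
proof -
  assume "s \<in> sigs" "divides_F x y"
  then have "s \<in> signatures m" "strictly_divides (snd x) (snd y)"
    using sigs_signatures by (simp_all add: divides_F_def subsetD)
  then show ?thesis
    using sig_times_closed[OF _ quotient_path] by (simp add: shift_def sig_zero_def)
qed

lemma shift_refl:
  assumes "s \<in> sigs" "\<not> generator_sig s"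
  shows "sig_zero (shift s x x) \<or> shift s x x = s"
proof -
  obtain p where "snd s = mono_of p" using assms(2) unfolding generator_sig_def by metis
  then obtain i where s: "s = (i, mono_of p)" by (cases s) simp
  show ?thesis
    unfolding shift_def quotient_refl sig_zero_def s sig_times_mono_of
    by (simp add: composable_def path_comp_def)
qed

text \<open>
  Functoriality of \<open>shift\<close> is the associativity of concatenation: the excess of \<open>z\<close> over \<open>x\<close> is
  the concatenation of the excesses of \<open>y\<close> over \<open>x\<close> and of \<open>z\<close> over \<open>y\<close>.
\<close>
sublocale heads: head_system "module_monomials r" path_length divides_F sigs "signatures m" less_E
  sig_zero generator_sig shift
proof
  show "finite (module_monomials r)" "finite sigs" "sigs \<subseteq> signatures m"
    "strict_total_on (signatures m) less_E"
    by (rule finite_monomials finite_sigs sigs_signatures less_E_total)+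
  show "shift (shift \<rho> \<mu> \<nu>) \<nu> \<kappa> = shift \<rho> \<mu> \<kappa>" if "divides_F \<mu> \<nu>" "divides_F \<nu> \<kappa>" for \<rho> \<mu> \<nu> \<kappa>
    unfolding shift_def quotient_trans[OF that]
    using sig_times_assoc[OF composable_quotients[OF that]] .
qed (use divides_F_refl divides_F_trans divides_F_length shift_closed shift_refl in blast)+

lemma below_iff: "heads.below = sig_less"
  by (intro ext) (simp add: heads.below_def sig_less_def sig_zero_def)

definition heads_of :: "('a, 'v, 'e, 'k) signed set \<Rightarrow> ((nat \<times> 'a) \<times> ('v, 'e, 'k) signature) set"
  where
  "heads_of G = (\<lambda>g. (lm_F (fst g), snd g)) ` G"

lemma heads_of_insert: "heads_of (insert g G) = insert (lm_F (fst g), snd g) (heads_of G)"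
  by (simp add: heads_of_def)

lemma heads_of_closed: "admissible G \<Longrightarrow> heads_of G \<subseteq> module_monomials r \<times> sigs"
  using admissibleD unfolding heads_of_def by (intro image_subsetI) simp

definition lex_le :: "nat list \<Rightarrow> nat list \<Rightarrow> bool" where
  "lex_le xs ys \<longleftrightarrow> xs = ys \<or> (xs, ys) \<in> lex less_than"

lemma trans_lex_less_than: "trans (lex less_than)"
  by (rule lex_transI) simp

lemma lex_le_trans: "lex_le xs ys \<Longrightarrow> lex_le ys zs \<Longrightarrow> lex_le xs zs"
  unfolding lex_le_def using trans_lex_less_than transD by metis

lemma lex_le_less_trans: "lex_le xs ys \<Longrightarrow> (ys, zs) \<in> lex less_than \<Longrightarrow> (xs, zs) \<in> lex less_than"
  unfolding lex_le_def using trans_lex_less_than transD by metis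

abbreviation head_potential :: "('a, 'v, 'e, 'k) signed set \<Rightarrow> nat list" where
  "head_potential G \<equiv> heads.potential (heads_of G)"

text \<open>
  The product of a signature with the quotient path comes from an actual small cofactor, so a
  head that reduces provides a reducer.
\<close>
lemma irreducible_heads:
  assumes G: "admissible G" and f: "f \<in> free_module A r" "f \<noteq> F_zero"
    and irred: "\<And>g c. \<not> reducer G s f g c" and h: "(\<mu>, \<rho>) \<in> heads_of G" "divides_F \<mu> (lm_F f)"
  shows "\<not> heads.below (shift \<rho> \<mu> (lm_F f)) s"
proof -
  obtain g where g: "g \<in> G" "\<mu> = lm_F (fst g)" "\<rho> = snd g" using h(1) unfolding heads_of_def
    by blast
  obtain c where "small_cofactor (snd \<mu>) c" "gen_mult A \<mu> c = lm_F f"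
    "sig_mult \<rho> c = shift \<rho> \<mu> (lm_F f)"
    using shift_attained[OF _ lm_F_in[OF f] h(2)] admissibleD(4)[OF G g(1)] g(2) by metis
  then show ?thesis
    using irred[of g c] g unfolding below_iff reducer_def small_cofactor_of_lm_def by metis
qed

lemma potential_insert_le:
  assumes G: "admissible G" and f: "fst f \<in> free_module A r" "fst f \<noteq> F_zero" "snd f \<in> sigs"
    "\<not> generator_sig (snd f)"
    and irred: "\<And>g c. \<not> reducer G (snd f) (fst f) g c"
  shows "lex_le (head_potential (insert f G)) (head_potential G)"
proof -
  note irr = irreducible_heads[OF G f(1,2) irred]
  note l = lm_F_in[OF f(1,2)]
  show ?thesis
  proof (cases "heads.redundant (heads_of G) (lm_F (fst f)) (snd f)")
    case True
    then show ?thesis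
      using heads.undominated_insert_redundant[OF heads_of_closed[OF G] l f(3,4) irr True]
      unfolding heads_of_insert lex_le_def heads.potential_def by simp
  next
    case False
    then show ?thesis
      using heads.potential_insert[OF heads_of_closed[OF G] l f(3,4) irr False]
      unfolding heads_of_insert lex_le_def by (metis insert_absorb)
  qed
qed

text \<open>
  If \<open>shift \<rho> \<mu> \<nu>\<close> were equal to the new signature for some head, then the corresponding
  multiple of the element with that head would have the same leading monomial as the new
  element. It would be irreducible along with the new element and cover the signature.
\<close>
lemma potential_insert_less:
  assumes G: "admissible G" and f: "fst f \<in> free_module A r" "fst f \<noteq> F_zero" "snd f \<in> sigs"
    "\<not> generator_sig (snd f)"
    and irred: "\<And>g c. \<not> reducer G (snd f) (fst f) g c" and new: "\<not> covered G (snd f)"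
  shows "(head_potential (insert f G), head_potential G) \<in> lex less_than"
proof -
  note irr = irreducible_heads[OF G f(1,2) irred]
  note l = lm_F_in[OF f(1,2)]
  have ne: "shift \<rho> \<mu> (lm_F (fst f)) \<noteq> snd f" if h: "(\<mu>, \<rho>) \<in> heads_of G"
    "divides_F \<mu> (lm_F (fst f))" for \<mu> \<rho>
  proof
    assume eq: "shift \<rho> \<mu> (lm_F (fst f)) = snd f"
    obtain g where g: "g \<in> G" "\<mu> = lm_F (fst g)" "\<rho> = snd g" using h(1) unfolding heads_of_def
      by blast
    obtain c where c: "small_cofactor (snd \<mu>) c" "gen_mult A \<mu> c = lm_F (fst f)"
      "sig_mult \<rho> c = snd f"
      using shift_attained[OF _ l h(2)] admissibleD(4)[OF G g(1)] g(2) eq by metis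
    have "lm_F (F_mult (fst g) c) = lm_F (fst f)"
      using lm_F_mult[OF admissibleD(1,2)[OF G g(1)]] c l g(2) by simp
    then have "irreducible G (snd f) (F_mult (fst g) c)"
      using irred unfolding irreducible_def reducer_def by metis
    then show False
      using new c g unfolding covered_def small_cofactor_of_lm_def by metis
  qed
  have "\<not> heads.redundant (heads_of G) (lm_F (fst f)) (snd f)"
    using irr ne unfolding heads.redundant_def by blast
  moreover have "(lm_F (fst f), snd f) \<notin> heads_of G"
    using irr[OF _ divides_F_refl[OF l]] ne[OF _ divides_F_refl[OF l]] shift_refl[OF f(3,4)]
    unfolding heads.below_def by blast
  ultimately show ?thesis
    using heads.potential_insert[OF heads_of_closed[OF G] l f(3,4) irr] unfolding heads_of_insert
      by blast
qed

lemma tame_insert: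
  assumes G: "admissible G" "heads.tame (heads_of G)" and f: "fst f \<in> free_module A r"
    "fst f \<noteq> F_zero" "snd f \<in> sigs"
    and irred: "\<And>g c. \<not> reducer G (snd f) (fst f) g c"
  shows "heads.tame (heads_of (insert f G))"
proof (cases "generator_sig (snd f)")
  case True
  then show ?thesis
    using G(2) lm_F_in[OF f(1,2)] f(3) unfolding heads_of_insert heads.tame_def by auto
next
  case False
  then show ?thesis
    unfolding heads_of_insert
    using heads.tame_insert[OF G(2) lm_F_in[OF f(1,2)] f(3) False
      irreducible_heads[OF G(1) f(1,2) irred]] by blast
qed

text \<open>
  Several elements may share a head, in which case the set of heads does not change.
\<close>
lemma potential_remove:
  assumes G: "admissible G" "heads.tame (heads_of G)" and gh: "g \<in> G" "h \<in> G" "h \<noteq> g"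
    and c: "small_cofactor (snd (lm_F (fst h))) c" "gen_mult A (lm_F (fst h)) c = lm_F (fst g)"
    and le: "sig_less (sig_mult (snd h) c) (snd g) \<or> sig_mult (snd h) c = snd g"
  shows "lex_le (head_potential (G - {g})) (head_potential G)"
proof (cases "(lm_F (fst g), snd g) \<in> heads_of (G - {g})")
  case True
  then have "heads_of (G - {g}) = heads_of G"
    using heads_of_insert[of g "G - {g}"] gh(1) by (simp add: insert_absorb)
  then show ?thesis by (simp add: lex_le_def)
next
  case False
  let ?x = "lm_F (fst h)" and ?y = "lm_F (fst g)"
  have H': "heads_of (G - {g}) = heads_of G - {(?y, snd g)}"
    using heads_of_insert[of g "G - {g}"] gh(1) False by (simp add: insert_absorb)
  have mem: "?x \<in> module_monomials r" "?y \<in> module_monomials r" using admissibleD(4)[OF G(1)] gh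
    by blast+
  have hG': "(?x, snd h) \<in> heads_of (G - {g})"
    unfolding heads_of_def by (rule rev_image_eqI[of h]) (use gh in simp_all)
  have hG: "(?x, snd h) \<in> heads_of G" using hG' unfolding H' by simp
  have ne: "(?x, snd h) \<noteq> (?y, snd g)" using hG' False by metis
  have s: "snd h \<in> signatures m" "snd g \<in> signatures m"
    using admissibleD(3)[OF G(1)] gh sigs_signatures by blast+
  have "heads.below (shift (snd h) ?x ?y) (snd g) \<or> shift (snd h) ?x ?y = snd g"
    using le
  proof
    assume "sig_less (sig_mult (snd h) c) (snd g)"
    then show ?thesis using sig_less_shift[OF s(1) mem c s(2)] by (simp add: below_iff)
  next
    assume "sig_mult (snd h) c = snd g"
    then show ?thesis using shift_least[OF s(1) mem c] unfolding heads.below_def by metis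
  qed
  then have "heads.undominated (heads_of (G - {g})) n \<subseteq> heads.undominated (heads_of G) n" for n
    unfolding H' using heads.undominated_remove[OF G(2) _ hG ne divides_if_cofactor[OF mem c]] gh(1)
    by (simp add: heads_of_def)
  then show ?thesis unfolding lex_le_def by (rule heads.potential_mono)
qed

definition weight_potential_le :: "('a, 'v, 'e, 'k) signed set \<Rightarrow>
    ('a, 'v, 'e, 'k) signed set \<Rightarrow> bool" where
  "weight_potential_le G G' \<longleftrightarrow> weight generator_sig G < weight generator_sig G' \<or>
    weight generator_sig G = weight generator_sig G' \<and>
      lex_le (head_potential G) (head_potential G')"

text \<open>
  If the signature of the element taken out is a generator, then the weight drops, which
  outranks any change of the potential. Otherwise the weight stays the same, and the step is a
  removal of a head, possibly followed by an insertion.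
\<close>
lemma interred_step_descends:
  assumes G: "admissible G" "heads.tame (heads_of G)" and step: "interred_step (G, L) S"
  shows "heads.tame (heads_of (fst S)) \<and> weight_potential_le (fst S) G"
  using G(1) step
proof (rule interred_stepE)
  fix g h c
  assume g: "g \<in> G" and h: "h \<in> G" "h \<noteq> g"
    and c: "small_cofactor (snd (lm_F (fst h))) c" "gen_mult A (lm_F (fst h)) c = lm_F (fst g)"
    and le: "sig_less (sig_mult (snd h) c) (snd g) \<or> sig_mult (snd h) c = snd g"
    and S: "fst S = G - {g} \<or> (\<exists>g'. fst S = insert g' (G - {g}) \<and> snd g' = snd g \<and>
       fst g' \<in> free_module A r \<and> fst g' \<noteq> F_zero \<and> less_F (lm_F (fst g')) (lm_F (fst g)) \<and>
       (\<forall>h c. \<not> reducer (G - {g}) (snd g) (fst g') h c))"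
  have admissible': "admissible (G - {g})" using admissible_subset[OF G(1)] by blast
  have "heads_of (G - {g}) \<subseteq> heads_of G" unfolding heads_of_def by blast
  then have tame': "heads.tame (heads_of (G - {g}))" by (rule heads.tame_subset[OF G(2)])
  note pot' = potential_remove[OF G g h c le]
  have tame: "heads.tame (heads_of (fst S))"
    using S tame' tame_insert[OF admissible' tame'] admissibleD(3)[OF G(1) g] by metis
  have "weight_potential_le (fst S) G"
  proof (cases "generator_sig (snd g)")
    case True
    then show ?thesis
      unfolding weight_potential_le_def using weight_step[OF G(1) g, of generator_sig "fst S"] S
        by blast
  next
    case False
    note w = weight_irrelevant(2)[of generator_sig g G, OF False]
    from S show ?thesis
    proof
      assume "fst S = G - {g}"
      then show ?thesis unfolding weight_potential_le_def using w pot' by simp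
    next
      assume "\<exists>g'. fst S = insert g' (G - {g}) \<and> snd g' = snd g \<and>
       fst g' \<in> free_module A r \<and> fst g' \<noteq> F_zero \<and> less_F (lm_F (fst g')) (lm_F (fst g)) \<and>
       (\<forall>h c. \<not> reducer (G - {g}) (snd g) (fst g') h c)"
      then obtain g' where g': "fst S = insert g' (G - {g})" "snd g' = snd g"
       "fst g' \<in> free_module A r" "fst g' \<noteq> F_zero"
       "\<And>h c. \<not> reducer (G - {g}) (snd g') (fst g') h c" by metis
      have ng: "\<not> generator_sig (snd g')" using False g'(2) by simp
      have "lex_le (head_potential (fst S)) (head_potential (G - {g}))"
        unfolding g'(1) using potential_insert_le[OF admissible' g'(3,4) _ ng g'(5)]
          admissibleD(3)[OF G(1) g] g'(2) by simp
      then show ?thesis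
        unfolding weight_potential_le_def g'(1)
        using w weight_irrelevant(1)[of generator_sig g' "G - {g}", OF ng] lex_le_trans[OF _ pot']
          by simp
    qed
  qed
  with tame show ?thesis by blast
qed

lemma weight_potential_le_trans:
  "weight_potential_le G G' \<Longrightarrow> weight_potential_le G' G'' \<Longrightarrow> weight_potential_le G G''"
  using lex_le_trans[of "head_potential G" "head_potential G'" "head_potential G''"]
    unfolding weight_potential_le_def
  by (elim disjE conjE) simp_all

lemma interred_steps_descend:
  assumes "admissible G" "heads.tame (heads_of G)" and steps: "interred_step\<^sup>*\<^sup>* (G, L) S"
  shows "admissible (fst S) \<and> heads.tame (heads_of (fst S)) \<and> weight_potential_le (fst S) G"
  using steps
proof (induction rule: rtranclp_induct)
  case base
  show ?case using assms(1,2) by (simp add: weight_potential_le_def lex_le_def)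
next
  case (step S S')
  have st: "interred_step (fst S, snd S) S'" using step.hyps(2) by simp
  from step.IH show ?case
    using interred_step_admissible[OF _ st] interred_step_descends[OF _ _ st]
      weight_potential_le_trans by blast
qed

end


section \<open>Termination of the main loop\<close>

context f5_basic_setting
begin

text \<open>
  A monomial contains itself as a factor, between two trivial paths.
\<close>
lemma standard_not_in: "standard L s \<Longrightarrow> s \<notin> L"
proof
  assume "standard L s" and sL: "s \<in> L"
  then obtain i c where c: "c \<in> std_mon" "s = (i, mono_of c)"
    and none: "\<not> (\<exists>c'\<in>paths Q. \<exists>b\<in>paths Q. \<exists>d\<in>paths Q. (i, mono_of c') \<in> L \<and>
         composable Q b c' \<and> composable Q c' d \<and> c = path_comp b (path_comp c' d))"
    unfolding standard_def by metis
  have cp: "c \<in> paths Q" using std_mon_paths[OF c(1)] .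
  have "(fst c, []) \<in> paths Q" "(path_end Q c, []) \<in> paths Q"
    using quiver.path_ends_in_verts[OF cp] by (simp_all add: trivial_path)
  then show False
    using none cp sL c(2) quiver.path_comp_trivial_left[OF cp]
      quiver.path_comp_trivial_right[OF cp] by metis
qed

lemma standard_sig: "standard L s \<Longrightarrow> s \<in> sigs \<and> \<not> generator_sig s"
proof
  assume "standard L s"
  then obtain i c where ic: "i < m" "c \<in> std_mon" "s = (i, mono_of c)" unfolding standard_def
    by metis
  then show "s \<in> sigs" unfolding sigs_def by (intro UnI1) force
  show "\<not> generator_sig s" using ic std_mon_paths by (simp add: generator_sig_def) metis
qed

lemma
  assumes G: "admissible G" and p: "selectable (G, L) p"
  shows S_poly_closed: "fst (S_poly p) \<in> free_module A r"
    and S_poly_sig: "standard L (snd (S_poly p))"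
proof -
  have cp: "critical_pair G p" "normal G L p" using p by (simp_all add: selectable_def)
  have "fst (S_poly p) \<in> free_module A r \<and> standard L (snd (S_poly p))"
  proof (cases p)
    case (Pair_T g c)
    then have "g \<in> G" "c \<in> basis" using cp(1) by (auto simp: minimal_toppling_def toppling_def)
    then show ?thesis
      using cp(2) Pair_T F_mult_closed[OF admissibleD(1)[OF G] basis_closed] by simp
  next
    case (Pair_S g g' c)
    then have "g \<in> G" "g' \<in> G" "c \<in> basis"
      using cp(1) by (simp_all add: small_cofactor_of_lm_def small_cofactor_def)
    then show ?thesis
      using cp(2) Pair_S F_diff_closed[OF F_mult_closed[OF admissibleD(1)[OF G] basis_closed]
        F_scale_closed[OF admissibleD(1)[OF G]]]
      by simp
  qed
  then show "fst (S_poly p) \<in> free_module A r" "standard L (snd (S_poly p))" by simp_all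
qed

lemma nf_S_poly:
  assumes G: "admissible G" and p: "selectable (G, L) p" and s: "nf G (S_poly p) s"
  shows "fst s \<in> free_module A r" "snd s = snd (S_poly p)" "snd s \<in> sigs" "\<not> generator_sig (snd s)"
    "snd s \<notin> L"
proof -
  have ss: "snd s = snd (S_poly p)" "(nf_step G (snd (S_poly p)))\<^sup>*\<^sup>* (fst (S_poly p)) (fst s)"
    using s by (simp_all add: nf_def)
  show "snd s = snd (S_poly p)" using ss(1) .
  have "nonzero_elements G" using G by (simp add: admissible_def)
  then show "fst s \<in> free_module A r" using nf_steps[OF _ S_poly_closed[OF G p] ss(2)] by simp
  show "snd s \<in> sigs" "\<not> generator_sig (snd s)" "snd s \<notin> L"
    unfolding ss(1) using standard_sig standard_not_in S_poly_sig[OF G p] by simp_all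
qed

lemma admissible_new_element:
  assumes "admissible G" "selectable (G, L) p" "nf G (S_poly p) s" "fst s \<noteq> F_zero"
  shows "admissible (insert s G)"
  using nf_S_poly[OF assms(1-3)] assms(1,4) by (simp add: admissible_insert)

definition f5_measure :: "('a, 'v, 'e, 'k) f5_state \<Rightarrow> (nat \<times> nat list) \<times> nat" where
  "f5_measure S = ((weight generator_sig (fst S), head_potential (fst S)), card (sigs - snd S))"

definition f5_order :: "(((nat \<times> nat list) \<times> nat) \<times> ((nat \<times> nat list) \<times> nat)) set" where
  "f5_order = (less_than <*lex*> lex less_than) <*lex*> less_than"

lemma f5_step_descends:
  assumes G: "admissible G" "heads.tame (heads_of G)" and step: "f5_step (G, L) S"
  shows "(admissible (fst S) \<and> heads.tame (heads_of (fst S))) \<and>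
    (f5_measure S, f5_measure (G, L)) \<in> f5_order"
  using step
proof (cases rule: f5_step.cases)
  case (syzygy p s)
  note s = nf_S_poly[OF G(1) syzygy(2,3)]
  have "sigs - insert (snd s) L \<subset> sigs - L" using s(3,5) by blast
  then have "card (sigs - insert (snd s) L) < card (sigs - L)"
    using finite_sigs by (intro psubset_card_mono) simp_all
  then show ?thesis using G syzygy(1) by (simp add: f5_measure_def f5_order_def)
next
  case (new_element p s)
  note s = nf_S_poly[OF G(1) new_element(1,2)]
  have "\<not> covered G (snd s)" using new_element(1) s(2) by (simp add: selectable_def)
  moreover have irred: "\<not> reducer G (snd s) (fst s) g c" for g c
    using nf_irreducible[OF new_element(2,3)] s(2) by simp
  ultimately have less: "(head_potential (insert s G), head_potential G) \<in> lex less_than"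
    using potential_insert_less[OF G(1) s(1) new_element(3) s(3,4)] by simp
  have "admissible (insert s G)" using admissible_new_element[OF G(1) new_element(1-3)] .
  moreover have "heads.tame (heads_of (insert s G))"
    using tame_insert[OF G s(1) new_element(3) s(3) irred] .
  moreover have "interred_step\<^sup>*\<^sup>* (insert s G, L) S" using new_element(4)
    by (simp add: interred_def)
  ultimately have S: "admissible (fst S)" "heads.tame (heads_of (fst S))"
      "weight_potential_le (fst S) (insert s G)"
    using interred_steps_descend by simp_all
  have "((weight generator_sig (fst S), head_potential (fst S)),
      (weight generator_sig G, head_potential G))
      \<in> less_than <*lex*> lex less_than"
    using S(3) lex_le_less_trans[OF _ less, of "head_potential (fst S)"]
      weight_irrelevant(1)[of generator_sig s G, OF s(4)]
    unfolding weight_potential_le_def by (elim disjE conjE) simp_all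
  with S show ?thesis by (simp add: f5_measure_def f5_order_def)
qed

lemma admissible_initial_set: "admissible initial_set"
proof -
  have "initial_set \<subseteq> (\<lambda>i. (gens i, (i, \<one>\<^bsub>P\<^esub>))) ` {..<m}"
    unfolding initial_set_def by blast
  then have "finite initial_set" by (rule finite_subset) simp
  moreover have "fst g \<in> free_module A r \<and> fst g \<noteq> F_zero \<and> snd g \<in> sigs" if g: "g \<in> initial_set"
    for g
  proof -
    obtain i where "g = (gens i, (i, \<one>\<^bsub>P\<^esub>))" "i < m" "gens i \<noteq> F_zero"
      using g unfolding initial_set_def by blast
    then show ?thesis using gens_closed by (simp add: sigs_def)
  qed
  ultimately show ?thesis unfolding admissible_def nonzero_elements_def
    by (simp add: image_subset_iff)
qed

text \<open>
  The product of a generator with a trivial path never vanishes, so tameness holds vacuously,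
  even where generators happen to be monomials.
\<close>
lemma tame_initial_set: "heads.tame (heads_of initial_set)"
proof -
  have "\<not> sig_zero (shift \<rho> \<nu> \<nu>)" if h: "(\<nu>, \<rho>) \<in> heads_of initial_set" for \<nu> \<rho>
  proof -
    obtain i where \<rho>: "\<rho> = (i, \<one>\<^bsub>P\<^esub>)"
      using h unfolding heads_of_def initial_set_def by auto
    have "\<nu> \<in> module_monomials r" using heads_of_closed[OF admissible_initial_set] h by blast
    then have "lam (snd \<nu>) \<in> paths Q" using lam_path by (simp add: mem_monomials)
    then have e: "(path_end Q (lam (snd \<nu>)), []) \<in> paths Q"
      using quiver.path_ends_in_verts by (intro trivial_path) simp
    show ?thesis
      unfolding shift_def quotient_refl \<rho> sig_zero_def sig_times_one[OF e] snd_conv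
      by (metis keys_single keys_zero insert_not_empty zero_neq_one)
  qed
  then show ?thesis unfolding heads.tame_def using heads_of_closed[OF admissible_initial_set]
    by blast
qed

theorem f5_terminates: f5_terminates
  unfolding f5_terminates_def
proof (intro conjI allI impI)
  show "interred_halts (initial_set, {})" using interred_halts[OF admissible_initial_set] .
  fix G0 L0
  assume "interred (initial_set, {}) (G0, L0)"
  then have "interred_step\<^sup>*\<^sup>* (initial_set, {}) (G0, L0)" by (simp add: interred_def)
  then have G0: "admissible G0" "heads.tame (heads_of G0)"
    using interred_steps_descend[OF admissible_initial_set tame_initial_set] by force+
  have inv: "(admissible (fst S') \<and> heads.tame (heads_of (fst S'))) \<and>
    (f5_measure S', f5_measure S) \<in> f5_order"
    if "admissible (fst S) \<and> heads.tame (heads_of (fst S))" "f5_step S S'" for S S'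
    using f5_step_descends[of "fst S" "snd S" S'] that by simp
  show "halts_from f5_step (G0, {})"
  proof (rule halts_from_measure[where
        Inv = "\<lambda>S. admissible (fst S) \<and> heads.tame (heads_of (fst S))" and R = f5_order
          and \<mu> = f5_measure])
    show "wf f5_order" unfolding f5_order_def by (intro wf_lex_prod wf_lex wf_less_than)
    show "admissible (fst (G0, {})) \<and> heads.tame (heads_of (fst (G0, {})))" using G0 by simp
  qed (rule inv)
  fix G L p
  assume reach: "f5_step\<^sup>*\<^sup>* (G0, {}) (G, L) \<and> selectable (G, L) p"
  then have "f5_step\<^sup>*\<^sup>* (G0, {}) (G, L)" by simp
  then have "admissible (fst (G, L)) \<and> heads.tame (heads_of (fst (G, L)))"
  proof (induction rule: rtranclp_induct)
    case base
    show ?case using G0 by simp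
  next
    case (step S S')
    then show ?case using inv by blast
  qed
  then have G: "admissible G" by simp
  then have "nonzero_elements G" by (simp add: admissible_def)
  then show "nf_halts G (S_poly p)" using nf_halts S_poly_closed[OF G] reach by blast
  show "interred_halts (insert s G, L)" if "nf G (S_poly p) s \<and> fst s \<noteq> F_zero" for s
    using interred_halts[OF admissible_new_element[OF G]] reach that by blast
qed

end

theorem lemma14:
  fixes Q :: "('v, 'e) pre_digraph"
    and A :: "('a, 'b) ring_scheme"
    and psi :: "(('v, 'e) path \<Rightarrow>\<^sub>0 'k::field) \<Rightarrow> 'a"
    and less_P :: "('v, 'e) path \<Rightarrow> ('v, 'e) path \<Rightarrow> bool"
    and r :: nat and less_F :: "nat \<times> 'a \<Rightarrow> nat \<times> 'a \<Rightarrow> bool"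
    and m :: nat and less_E :: "('v, 'e, 'k) signature \<Rightarrow> ('v, 'e, 'k) signature \<Rightarrow> bool"
    and gens :: "nat \<Rightarrow> nat \<Rightarrow> 'a"
  assumes "f5_setting Q A psi less_P r less_F m less_E gens"
    and "path_algebra_quotient.basic_algebra Q A psi"
  shows "f5_setting.f5_terminates Q A psi less_P r less_F m less_E gens"
proof -
  interpret f5_basic_setting Q A psi less_P r less_F m less_E gens
    using assms by (intro f5_basic_setting.intro f5_basic_setting_axioms.intro)
  show ?thesis by (rule f5_terminates)
qed

end
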